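(* Let $n\ge 2$. There exists $M_0\ge 2$ such that for every $M\ge M_0$ the following holds. Let $\varphi$ be the plurisubharmonic function on $\mathbb{C}^n$ defined by $$\varphi(z)=\log|z_1|+\sum_{k=1}^{\infty}\alpha_k\log\Big(|z_1|+\Big|\frac{z_2}{k}\Big|^{\beta_k}\Big),\qquad \alpha_k=M^{-k},\quad \beta_k=M^{2k}.$$ Let $\varphi_A$ be any plurisubharmonic function with generalized analytic singularities near the origin $o\in\mathbb{C}^n$. Then $e^{-2\varphi}-e^{-2\varphi_A}$ is not locally integrable near $o$.
   Context: Local integrability is with respect to Lebesgue measure. A (pluri)subharmonic function $\varphi$ has analytic singularities if locally it can be written as $\varphi=\frac{c}{2}\log\big(\sum_{k=1}^{m}|f_k|^2\big)+O(1)$ with $c\in\mathbb{R}^+$ and $f_k$ holomorphic functions (the $f_k$ may all vanish identically, so that a restriction of a function to a line that is identically $-\infty$ is allowed below). A plurisubharmonic function $\varphi$ on a complex manifold $X$ has generalized analytic singularities if for any point $x_0\in X$ there exists a ball $B_r(x_0)$ such that for every complex line $L\subset B_r(x_0)$ (i.e. the intersection of an affine complex line with the ball), $\varphi|_L$ has analytic singularities. "Near $o$" means on some open neighborhood $X$ of $o$ in $\mathbb{C}^n$. *)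

theory Defs
  imports "HOL-Analysis.Analysis" "HOL-Complex_Analysis.Complex_Analysis"
begin

definition elog :: "real \<Rightarrow> ereal" where
  "elog x = (if 0 < x then ereal (ln x) else - \<infinity>)"

fun eexp :: "ereal \<Rightarrow> ereal" where
  "eexp (ereal r) = ereal (exp r)"
| "eexp PInfty = \<infinity>"
| "eexp MInfty = 0"

text \<open>
  Lebesgue integral of an extended real function, positive part minus negative part
  (\<^const>\<open>e2ennreal\<close> truncates negative values to 0).  It is used below only for functions
  that are bounded above on a space of finite measure, so the positive part has finite
  integral and the value lies in \<open>[-\<infinity>, \<infinity>)\<close>.
\<close>

definition ext_integral :: "'a measure \<Rightarrow> ('a \<Rightarrow> ereal) \<Rightarrow> ereal" where
  "ext_integral M f =
     enn2ereal (\<integral>\<^sup>+ x. e2ennreal (f x) \<partial>M) - enn2ereal (\<integral>\<^sup>+ x. e2ennreal (- f x) \<partial>M)"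

definition upper_semicontinuous_on :: "'a::topological_space set \<Rightarrow> ('a \<Rightarrow> ereal) \<Rightarrow> bool" where
  "upper_semicontinuous_on S u \<longleftrightarrow>
     (\<forall>x\<in>S. \<forall>c. u x < c \<longrightarrow> (\<forall>\<^sub>F y in at x within S. u y < c))"

text \<open>
  Subharmonic functions take values in \<open>[-\<infinity>, \<infinity>)\<close>; the function that is identically
  \<open>-\<infinity>\<close> is allowed, so that restrictions of plurisubharmonic functions to complex lines
  are subharmonic without exception.
\<close>

definition subharmonic_on :: "complex set \<Rightarrow> (complex \<Rightarrow> ereal) \<Rightarrow> bool" where
  "subharmonic_on S u \<longleftrightarrow>
     open S \<and> (\<forall>w\<in>S. u w < \<infinity>) \<and> upper_semicontinuous_on S u \<and>
     (\<forall>a r. 0 < r \<and> cball a r \<subseteq> S \<longrightarrow>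
        u a \<le> ereal (1 / (2 * pi)) *
          ext_integral (lebesgue_on {0..2 * pi}) (\<lambda>t. u (a + complex_of_real r * cis t)))"

text \<open>
  The restriction to the affine complex line through \<open>a\<close> with direction \<open>b\<close> is expressed in
  the affine parameter \<open>w \<mapsto> a + w *s b\<close> of that line.
\<close>

definition plurisubharmonic_on ::
    "(complex ^ 'n::finite) set \<Rightarrow> (complex ^ 'n \<Rightarrow> ereal) \<Rightarrow> bool" where
  "plurisubharmonic_on X u \<longleftrightarrow>
     open X \<and> (\<forall>z\<in>X. u z < \<infinity>) \<and> upper_semicontinuous_on X u \<and>
     (\<forall>a b. b \<noteq> 0 \<longrightarrow> subharmonic_on {w. a + w *s b \<in> X} (\<lambda>w. u (a + w *s b)))"

text \<open>
  The \<open>O(1)\<close> is written as a two-sided bound, so that both sides are \<open>-\<infinity>\<close> at the same points.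
  The \<open>f k\<close> may all vanish identically.
\<close>

definition analytic_singularities_on :: "complex set \<Rightarrow> (complex \<Rightarrow> ereal) \<Rightarrow> bool" where
  "analytic_singularities_on S u \<longleftrightarrow>
     (\<forall>w0\<in>S. \<exists>V (c::real) (m::nat) (f :: nat \<Rightarrow> complex \<Rightarrow> complex) (C::real).
        open V \<and> w0 \<in> V \<and> V \<subseteq> S \<and> 0 < c \<and> 1 \<le> m \<and> (\<forall>k\<in>{1..m}. f k holomorphic_on V) \<and>
        (\<forall>w\<in>V. ereal (c / 2) * elog (\<Sum>k=1..m. (cmod (f k w))\<^sup>2) - ereal C \<le> u w \<and>
                u w \<le> ereal (c / 2) * elog (\<Sum>k=1..m. (cmod (f k w))\<^sup>2) + ereal C))"

definition generalized_analytic_singularities_on ::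
    "(complex ^ 'n::finite) set \<Rightarrow> (complex ^ 'n \<Rightarrow> ereal) \<Rightarrow> bool" where
  "generalized_analytic_singularities_on X u \<longleftrightarrow>
     (\<forall>x0\<in>X. \<exists>r>0. ball x0 r \<subseteq> X \<and>
        (\<forall>a b. b \<noteq> 0 \<longrightarrow>
           analytic_singularities_on {w. a + w *s b \<in> ball x0 r} (\<lambda>w. u (a + w *s b))))"

definition ext_integrable_on :: "'a::euclidean_space set \<Rightarrow> ('a \<Rightarrow> ereal) \<Rightarrow> bool" where
  "ext_integrable_on U f \<longleftrightarrow>
     f \<in> borel_measurable (lebesgue_on U) \<and>
     (\<integral>\<^sup>+ x. e2ennreal \<bar>f x\<bar> \<partial>lebesgue_on U) < \<infinity>"

definition locally_integrable_on :: "'a::euclidean_space set \<Rightarrow> ('a \<Rightarrow> ereal) \<Rightarrow> bool" where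
  "locally_integrable_on U f \<longleftrightarrow>
     (\<forall>x\<in>U. \<exists>V. open V \<and> x \<in> V \<and> V \<subseteq> U \<and> ext_integrable_on V f)"

text \<open>
  The coordinates \<open>z\<^sub>1, z\<^sub>2\<close> are the components with indices \<open>i1, i2\<close>, and the series starting
  at \<open>k = 1\<close> is indexed by \<open>Suc k\<close>.
\<close>

definition phi :: "'n::finite \<Rightarrow> 'n \<Rightarrow> real \<Rightarrow> complex ^ 'n \<Rightarrow> ereal" where
  "phi i1 i2 M z =
     elog (cmod (z $ i1)) +
     (\<Sum>k. (let j = Suc k; \<alpha> = 1 / M ^ j; \<beta> = M ^ (2 * j) in
        ereal \<alpha> * elog (cmod (z $ i1) + cmod (z $ i2 / of_nat j) powr \<beta>)))"

text \<open>
  At points where \<open>\<phi> = \<phi>A = -\<infinity>\<close> the difference \<open>exp (-2 \<phi>) - exp (-2 \<phi>A)\<close> below is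
  \<open>\<infinity> - \<infinity>\<close>, which is \<open>\<infinity>\<close> in \<^typ>\<open>ereal\<close>.  For \<open>\<phi> = phi i1 i2 M\<close> with \<open>M \<ge> 2\<close> these points lie
  in the Lebesgue null set \<open>z $ i1 = 0\<close>, so the convention does not affect integrability.
\<close>

definition exp_diff :: "('a \<Rightarrow> ereal) \<Rightarrow> ('a \<Rightarrow> ereal) \<Rightarrow> 'a \<Rightarrow> ereal" where
  "exp_diff \<phi> \<phi>A z = eexp (- 2 * \<phi> z) - eexp (- 2 * \<phi>A z)"

end

theory Submission
  imports Defs
begin

text \<open>
  The weights \<open>exp (-2\<phi>)\<close> and \<open>exp (-2\<phi>A)\<close> are compared on a single complex line parallel to the first coordinate axis.
  Fix \<open>z\<close> near the origin with \<open>z\<^sub>2 \<noteq> 0\<close> and let \<open>s = - log \<bar>z\<^sub>1\<bar>\<close> tend to infinity along that line.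
  Every term of the series is bounded there, since it converges to
  \<open>\<alpha>\<^sub>k \<beta>\<^sub>k log \<bar>z\<^sub>2/k\<bar> = M\<^sup>k log \<bar>z\<^sub>2/k\<bar>\<close>, but these limits are not summable. The series therefore
  tends to \<open>-\<infinity>\<close> (lemma \<open>log_series_at_bot\<close>), yet more slowly than any multiple of \<open>s\<close>, because the tail
  is at least \<open>-s\<close> times the tail of the convergent series of the \<open>\<alpha>\<^sub>k\<close> (lemma
  \<open>log_series_sublogarithmic\<close>). Hence \<open>exp (-2\<phi>)\<close> is \<open>\<bar>z\<^sub>1\<bar>\<close> to the power \<open>-2\<close> times a factor that is
  unbounded but smaller than every negative power of \<open>\<bar>z\<^sub>1\<bar>\<close>.

  Analytic singularities cannot imitate this. On the same line \<open>exp (-2\<phi>A)\<close> is either identically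
  infinite or comparable to an exact power of \<open>\<bar>z\<^sub>1\<bar>\<close>, with exponent \<open>-2q\<close> say (lemma
  \<open>analytic_singularities_exp\<close>). For \<open>q \<le> 1\<close> the first weight dominates, for \<open>q > 1\<close> the second one, and
  in each case the difference is at least \<open>\<bar>z\<^sub>1\<bar>\<close> to the power \<open>-2\<close> (lemma \<open>slice_weight_gap\<close>), which is
  not integrable in the plane. On the other hand, by Tonelli's theorem, local integrability of the
  difference near the origin would make it integrable on almost every such line.

  It remains to see that \<open>\<phi>\<close> is plurisubharmonic. As a function of \<open>log \<bar>z\<^sub>1\<bar>\<close> and \<open>log \<bar>z\<^sub>2\<bar>\<close> it is convex
  and increasing, so it lies above its tangent plane at any point, and that plane has nonnegative slopes
  (lemma \<open>log_series_tangent\<close>). The tangent plane at the centre of a circle in a complex line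
  is a constant plus a nonnegative combination of logarithms of moduli of affine functions. The mean
  value inequality for \<open>\<phi>\<close> thus follows from the one for \<open>log \<bar>c + d w\<bar>\<close>. All of this holds for every
  \<open>M \<ge> 2\<close>, so \<open>M0 = 2\<close> serves.
\<close>

section \<open>The logarithmic series in polar variables\<close>

text \<open>
  The summand with index \<open>j\<close> depends on \<open>z\<^sub>2\<close> only through this quantity at \<open>y = \<bar>z\<^sub>2\<bar>\<close>. As
  \<open>0 powr \<beta> = 0\<close>, it vanishes at \<open>y = 0\<close> as it should.
\<close>

definition power_term :: "real \<Rightarrow> real \<Rightarrow> nat \<Rightarrow> real" where
  "power_term M y j = (y / real j) powr (M ^ (2 * j))"

definition log_series :: "real \<Rightarrow> real \<Rightarrow> real \<Rightarrow> real" where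
  "log_series M x y = (\<Sum>k. 1 / M ^ Suc k * ln (x + power_term M y (Suc k)))"

lemma power_term_nonneg [simp]: "0 \<le> power_term M y j"
  by (simp add: power_term_def)

lemma power_term_pos: "0 < y \<Longrightarrow> 0 < j \<Longrightarrow> 0 < power_term M y j"
  by (simp add: power_term_def)

lemma power_term_zero [simp]: "power_term M 0 j = 0"
  by (simp add: power_term_def)

lemma power_term_le_one:
  assumes "M \<ge> 2" "0 \<le> y" "y \<le> real j" shows "power_term M y j \<le> 1"
proof (cases "j = 0")
  case False
  then have "0 \<le> y / real j" "y / real j \<le> 1" using assms by auto
  then show ?thesis unfolding power_term_def using assms by (intro powr_le1) auto
qed (simp add: power_term_def)

lemma ln_power_term:
  assumes "0 < y" "0 < j" shows "ln (power_term M y j) = M ^ (2*j) * ln (y / real j)"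
  using assms by (simp add: power_term_def ln_powr)

lemma weight_times_exponent:
  assumes "M \<ge> (2::real)" shows "1 / M ^ j * (M ^ (2*j) * a) = M ^ j * a"
proof -
  have "M ^ (2*j) = M ^ j * M ^ j" by (simp only: mult_2 power_add)
  then show ?thesis using assms by simp
qed

text \<open>
  The product \<open>\<alpha>\<^sub>j \<beta>\<^sub>j\<close> of the two parameters is \<open>M ^ j\<close>: this growth is what makes the boundary values
  of the series diverge.
\<close>

lemma weight_ln_power_term:
  assumes "M \<ge> 2" "0 < y" "0 < j" shows "1 / M ^ j * ln (power_term M y j) = M ^ j * ln (y / real j)"
  using assms by (simp only: ln_power_term weight_times_exponent)

lemma summable_weights:
  assumes "M \<ge> (2::real)" shows "summable (\<lambda>k. 1 / M ^ Suc k)"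
proof -
  have "summable (\<lambda>k. (1/M) ^ Suc k)"
    using assms by (subst summable_Suc_iff) (intro summable_geometric, auto)
  then show ?thesis by (simp add: power_one_over)
qed

lemma abs_ln_le:
  fixes m x R t :: real
  assumes "0 < m" "m \<le> x" "x \<le> R" "0 \<le> t" "t \<le> 1"
  shows "\<bar>ln (x + t)\<bar> \<le> \<bar>ln m\<bar> + \<bar>ln (R + 1)\<bar>"
proof -
  have "ln m \<le> ln (x + t)" using assms by (intro ln_mono) auto
  moreover have "ln (x + t) \<le> ln (R + 1)" using assms by (intro ln_mono) auto
  ultimately show ?thesis by linarith
qed

text \<open>
  The Weierstrass test applies because the power terms are at most 1 as soon as \<open>j \<ge> R\<close>, so that the
  logarithms in the tail are uniformly bounded. The absolute value allows \<open>y\<close> to range over an interval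
  with 0 in its interior, and thus the limit to be continuous on an open set.
\<close>

lemma uniform_limit_log_series:
  assumes M: "M \<ge> 2" and mR: "0 < m"
  shows "uniform_limit ({m..R} \<times> {-R..R}) (\<lambda>n p. \<Sum>k<n. 1 / M ^ Suc k * ln (fst p + power_term M \<bar>snd p\<bar> (Suc k)))
           (\<lambda>p. log_series M (fst p) \<bar>snd p\<bar>) sequentially"
  unfolding log_series_def
proof (rule Weierstrass_m_test_ev)
  show "summable (\<lambda>k. 1 / M ^ Suc k * (\<bar>ln m\<bar> + \<bar>ln (R + 1)\<bar>))"
    by (intro summable_mult2 summable_weights M)
  obtain N where N: "R \<le> real N" using real_arch_simple by blast
  show "\<forall>\<^sub>F k in sequentially. \<forall>p\<in>{m..R} \<times> {-R..R}.
      norm (1 / M ^ Suc k * ln (fst p + power_term M \<bar>snd p\<bar> (Suc k))) \<le> 1 / M ^ Suc k * (\<bar>ln m\<bar> + \<bar>ln (R + 1)\<bar>)"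
    using eventually_ge_at_top[of N]
  proof eventually_elim
    case (elim k)
    show ?case
    proof
      fix p assume p: "p \<in> {m..R} \<times> {-R..R}"
      have "\<bar>snd p\<bar> \<le> R" using p by auto
      also have "R \<le> real (Suc k)" using N elim by simp
      finally have "power_term M \<bar>snd p\<bar> (Suc k) \<le> 1" using M by (intro power_term_le_one) auto
      then have "\<bar>ln (fst p + power_term M \<bar>snd p\<bar> (Suc k))\<bar> \<le> \<bar>ln m\<bar> + \<bar>ln (R + 1)\<bar>"
        using p mR by (intro abs_ln_le) auto
      then show "norm (1 / M ^ Suc k * ln (fst p + power_term M \<bar>snd p\<bar> (Suc k))) \<le> 1 / M ^ Suc k * (\<bar>ln m\<bar> + \<bar>ln (R + 1)\<bar>)"
        using M by (simp add: abs_mult divide_right_mono)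
    qed
  qed
qed

lemma sums_log_series:
  assumes M: "M \<ge> 2" and "0 < x" "0 \<le> y"
  shows "(\<lambda>k. 1 / M ^ Suc k * ln (x + power_term M y (Suc k))) sums log_series M x y"
proof -
  have "(x, y) \<in> {x..x+y} \<times> {-(x+y)..x+y}" using assms by auto
  from tendsto_uniform_limitI[OF uniform_limit_log_series[OF M \<open>0 < x\<close>] this]
  show ?thesis using assms by (simp add: sums_def)
qed

lemma continuous_on_power_term_abs: "M \<ge> 2 \<Longrightarrow> continuous_on A (\<lambda>p::real \<times> real. power_term M \<bar>snd p\<bar> (Suc k))"
  unfolding power_term_def by (intro continuous_on_powr' continuous_intros) auto

lemma continuous_on_log_series:
  assumes M: "M \<ge> 2"
  shows "continuous_on {p::real \<times> real. 0 < fst p} (\<lambda>p. log_series M (fst p) \<bar>snd p\<bar>)"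
proof -
  let ?f = "\<lambda>p::real \<times> real. log_series M (fst p) \<bar>snd p\<bar>"
  have "isCont ?f p" if p: "0 < fst p" for p
  proof -
    define m where "m = fst p / 2"
    define R where "R = fst p + \<bar>snd p\<bar> + 1"
    have m: "0 < m" using p by (simp add: m_def)
    have "continuous_on ({m..R} \<times> {-R..R}) ?f"
    proof (rule uniform_limit_theorem[OF _ uniform_limit_log_series[OF M m]])
      show "\<forall>\<^sub>F n in sequentially. continuous_on ({m..R} \<times> {- R..R})
         (\<lambda>p. \<Sum>k<n. 1 / M ^ Suc k * ln (fst p + power_term M \<bar>snd p\<bar> (Suc k)))"
      proof (intro always_eventually allI continuous_on_sum continuous_on_mult continuous_on_const
          continuous_on_ln continuous_on_add continuous_on_fst continuous_on_id continuous_on_power_term_abs M ballI)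
        fix k and q :: "real \<times> real" assume "q \<in> {m..R} \<times> {- R..R}"
        then have "0 < fst q + power_term M \<bar>snd q\<bar> (Suc k)" using m by (intro add_pos_nonneg) auto
        then show "fst q + power_term M \<bar>snd q\<bar> (Suc k) \<noteq> 0" by simp
      qed
    qed simp
    moreover have "{m<..<R} \<times> {-R<..<R} \<subseteq> {m..R} \<times> {-R..R}" by auto
    ultimately have "continuous_on ({m<..<R} \<times> {-R<..<R}) ?f" by (rule continuous_on_subset)
    moreover have "p \<in> {m<..<R} \<times> {-R<..<R}" using p by (cases p) (auto simp: m_def R_def)
    moreover have "open ({m<..<R} \<times> {-R<..<R})" by (intro open_Times) auto
    ultimately show ?thesis using continuous_on_eq_continuous_at by blast
  qed
  then show ?thesis by (intro continuous_at_imp_continuous_on) auto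
qed

text \<open>
  Concavity of the logarithm (weighted arithmetic and geometric means): in the variables \<open>ln x\<close> and \<open>ln t\<close>
  the function \<open>ln (x + t)\<close> lies above its tangent plane at \<open>(ln x0, ln t0)\<close>.
\<close>

lemma ln_add_tangent:
  fixes x x0 t t0 :: real
  assumes "0 < x" "0 < x0" "0 < t" "0 < t0"
  shows "ln (x + t) - ln (x0 + t0) \<ge> x0/(x0+t0) * (ln x - ln x0) + t0/(x0+t0) * (ln t - ln t0)"
proof -
  define l where "l = x0/(x0+t0)"
  have l: "0 \<le> l" "l \<le> 1" "1 - l = t0/(x0+t0)" using assms by (auto simp: l_def field_simps)
  have "concave_on {0<..} ln" by (rule ln_concave)
  from concave_onD[OF this, of "1-l" "x/x0" "t/t0"] l(1,2) assms
  have "l * ln (x/x0) + (1-l) * ln (t/t0) \<le> ln (l * (x/x0) + (1-l) * (t/t0))" by simp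
  also have "l * (x/x0) = x/(x0+t0)" using assms by (simp add: l_def)
  also have "(1-l) * (t/t0) = t/(x0+t0)" using assms by (simp add: l(3))
  also have "x/(x0+t0) + t/(x0+t0) = (x+t)/(x0+t0)" by (simp add: add_divide_distrib)
  also have "ln \<dots> = ln (x+t) - ln (x0+t0)" using assms by (simp add: ln_div)
  finally show ?thesis using assms l by (simp add: ln_div l_def)
qed

text \<open>
  Summing the tangent plane inequalities of the individual terms gives one for the series. The slope
  \<open>P\<close> is a sum of at most \<open>\<alpha>\<^sub>k\<close> each. The summands of \<open>Q\<close> carry the large factor \<open>\<alpha>\<^sub>k \<beta>\<^sub>k\<close>, which is
  compensated by the power term at \<open>y0\<close>, eventually at most \<open>exp (-\<beta>\<^sub>k) \<le> 1/\<beta>\<^sub>k\<close>. For \<open>y0 = 0\<close> there is no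
  tangent plane in \<open>ln y\<close>, but the terms increase with \<open>y\<close>, so that the slope 0 serves.
\<close>

lemma log_series_tangent:
  assumes M: "M \<ge> 2" and x0: "0 < x0" and y0: "0 \<le> y0"
  obtains P Q where "0 \<le> P" "0 \<le> Q"
    "\<And>x y. 0 < x \<Longrightarrow> 0 \<le> y \<Longrightarrow> y0 = 0 \<or> 0 < y \<Longrightarrow>
       log_series M x y \<ge> log_series M x0 y0 + P * (ln x - ln x0) + (if y0 = 0 then 0 else Q * (ln y - ln y0))"
proof -
  define t where "t k = power_term M y0 (Suc k)" for k
  define p where "p k = 1 / M ^ Suc k * (x0 / (x0 + t k))" for k
  define q where "q k = M ^ Suc k * (t k / (x0 + t k))" for k
  have t: "0 \<le> t k" for k by (simp add: t_def)
  have p: "0 \<le> p k" and q: "0 \<le> q k" for k using M x0 t[of k] by (simp_all add: p_def q_def)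
  have sp: "summable p"
  proof (rule summable_comparison_test[OF _ summable_weights[OF M]], intro exI[of _ 0] allI impI)
    fix k show "norm (p k) \<le> 1 / M ^ Suc k"
      using p[of k] t[of k] x0 M unfolding p_def real_norm_def
      by (subst abs_of_nonneg, simp) (intro mult_left_le, auto simp: divide_le_eq)
  qed
  have sq: "summable q"
  proof (rule summable_comparison_test[OF _ summable_mult[OF summable_weights[OF M], of "1/x0"]])
    \<comment> \<open>From N on the logarithm of y0 / Suc k is at most -1.\<close>
    obtain N where N: "exp 1 * y0 \<le> real N" using real_arch_simple by blast
    show "\<exists>N. \<forall>k\<ge>N. norm (q k) \<le> 1 / x0 * (1 / M ^ Suc k)"
    proof (intro exI[of _ N] allI impI)
      fix k assume "N \<le> k"
      define B where "B = M ^ (2 * Suc k)"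
      have "0 < B" using M by (simp add: B_def)
      moreover have "B = M ^ Suc k * M ^ Suc k" by (simp only: B_def mult_2 power_add)
      ultimately have B: "0 < B" "B = M ^ Suc k * M ^ Suc k" by blast+
      have "t k \<le> 1 / B"
      proof (cases "y0 = 0")
        case False
        have "exp 1 * y0 \<le> real (Suc k)" using N \<open>N \<le> k\<close> by simp
        then have "y0 / real (Suc k) \<le> exp (-1)" by (simp add: exp_minus field_simps)
        then have "ln (y0 / real (Suc k)) \<le> -1" using False y0
          by (metis ln_exp ln_mono divide_pos_pos less_eq_real_def of_nat_0_less_iff zero_less_Suc)
        then have "ln (t k) \<le> - B" using False y0 mult_left_mono[of "ln (y0 / real (Suc k))" "-1" B] B(1)
          unfolding t_def by (subst ln_power_term) (auto simp: B_def simp del: power_Suc)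
        moreover have "ln B \<le> B" using ln_le_minus_one[OF B(1)] by simp
        ultimately have "ln (t k) \<le> ln (1 / B)" using B by (simp add: ln_div)
        moreover have "0 < t k" unfolding t_def using False y0 by (intro power_term_pos) auto
        ultimately show ?thesis using B(1) by (simp add: ln_le_cancel_iff)
      qed (use B in \<open>simp add: t_def\<close>)
      then have "t k / (x0 + t k) \<le> (1 / B) / x0" using t[of k] x0 B(1) by (intro frac_le) auto
      then have "q k \<le> M ^ Suc k * ((1 / B) / x0)" unfolding q_def using M by (intro mult_left_mono) auto
      also have "\<dots> = 1 / x0 * (1 / M ^ Suc k)" using M unfolding B(2) by simp
      finally show "norm (q k) \<le> 1 / x0 * (1 / M ^ Suc k)" using q by simp
    qed
  qed
  show thesis
  proof (rule that[of "suminf p" "suminf q"])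
    show "0 \<le> suminf p" "0 \<le> suminf q" using sp sq p q by (auto intro: suminf_nonneg)
    fix x y :: real assume x: "0 < x" and y: "0 \<le> y" "y0 = 0 \<or> 0 < y"
    define d where "d = (if y0 = 0 then 0 else ln y - ln y0)"
    have "(\<lambda>k. 1 / M ^ Suc k * ln (x0 + t k) + p k * (ln x - ln x0) + q k * d) sums
       (log_series M x0 y0 + suminf p * (ln x - ln x0) + suminf q * d)"
      unfolding t_def using sp sq by (intro sums_add sums_mult2 sums_log_series M x0 y0 summable_sums)
    moreover have "(\<lambda>k. 1 / M ^ Suc k * ln (x + power_term M y (Suc k))) sums log_series M x y"
      using M x y by (intro sums_log_series)
    moreover have "1 / M ^ Suc k * ln (x0 + t k) + p k * (ln x - ln x0) + q k * d
        \<le> 1 / M ^ Suc k * ln (x + power_term M y (Suc k))" for k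
    proof (cases "y0 = 0")
      case True
      then have "t k = 0" by (simp add: t_def)
      have "ln x \<le> ln (x + power_term M y (Suc k))" using x by (intro ln_mono) auto
      then have "1 / M ^ Suc k * ln x \<le> 1 / M ^ Suc k * ln (x + power_term M y (Suc k))"
        using M by (intro mult_left_mono) auto
      then show ?thesis using \<open>t k = 0\<close> x0 True
        by (simp add: p_def q_def right_diff_distrib del: power_Suc)
    next
      case False
      have pos: "0 < t k" "0 < power_term M y (Suc k)" "0 < y" "0 < y0"
        unfolding t_def using False y0 y by (auto intro!: power_term_pos)
      have "ln (power_term M y (Suc k)) - ln (t k) = M ^ (2 * Suc k) * d"
        using False pos unfolding t_def
        by (subst (1 2) ln_power_term) (auto simp: d_def ln_div algebra_simps simp del: power_Suc)
      then have "x0/(x0+t k) * (ln x - ln x0) + t k/(x0+t k) * (M ^ (2 * Suc k) * d)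
          \<le> ln (x + power_term M y (Suc k)) - ln (x0 + t k)"
        using ln_add_tangent[OF x x0 pos(2,1)] by simp
      then have "1 / M ^ Suc k * (x0/(x0+t k) * (ln x - ln x0) + t k/(x0+t k) * (M ^ (2 * Suc k) * d))
          \<le> 1 / M ^ Suc k * (ln (x + power_term M y (Suc k)) - ln (x0 + t k))"
        using M by (intro mult_left_mono) auto
      moreover have "1 / M ^ Suc k * (t k/(x0+t k) * (M ^ (2 * Suc k) * d)) = q k * d"
        using weight_times_exponent[OF M, of "Suc k" "t k/(x0+t k) * d"]
        by (simp only: q_def ac_simps)
      ultimately show ?thesis by (simp only: p_def distrib_left right_diff_distrib mult.assoc)
    qed
    ultimately have "log_series M x0 y0 + suminf p * (ln x - ln x0) + suminf q * d \<le> log_series M x y"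
      by (rule sums_le[rotated 1])
    then show "log_series M x0 y0 + suminf p * (ln x - ln x0) + (if y0 = 0 then 0 else suminf q * (ln y - ln y0)) \<le> log_series M x y"
      by (auto simp: d_def)
  qed
qed

text \<open>
  For small \<open>x\<close> and \<open>y\<close> no term is positive, so one term bounds the sum, and the limit
  \<open>M ^ j * ln (y / j)\<close> of the term with index \<open>j\<close> is as negative as desired when \<open>j\<close> is large.
\<close>

lemma log_series_at_bot:
  assumes M: "M \<ge> 2" and y: "0 < y" "y \<le> 1/2"
  obtains r where "0 < r" "\<And>x. 0 < x \<Longrightarrow> x < r \<Longrightarrow> log_series M x y \<le> - B"
proof -
  obtain K0 where K0: "(B + ln 2) / ln 2 < real K0" using reals_Archimedean2 by blast
  \<comment> \<open>Below this threshold x is dominated by the power term with index K0 + 1, and all arguments of logarithms are at most 1.\<close>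
  define r where "r = min (1/2) (power_term M y (Suc K0))"
  show thesis
  proof (rule that)
    show "0 < r" using y by (simp add: r_def power_term_pos)
    fix x assume x: "0 < x" "x < r"
    define f where "f k = 1 / M ^ Suc k * ln (x + power_term M y (Suc k))" for k
    have t: "power_term M y j \<le> 1/2" if "0 < j" for j
    proof -
      have yj: "0 \<le> y / real j" "y / real j \<le> y" using that y by (auto simp: divide_le_eq mult_le_cancel_left1)
      have "(y / real j) powr (M ^ (2*j)) \<le> (y / real j) powr 1"
        using yj y M that by (intro powr_mono') auto
      then show ?thesis using yj y that by (simp add: power_term_def)
    qed
    have np: "f k \<le> 0" for k
      unfolding f_def using t[of "Suc k"] x M power_term_nonneg[of M y "Suc k"]
      by (intro mult_nonneg_nonpos ln_le_zero_iff[THEN iffD2]) (auto simp: r_def add_pos_nonneg simp del: power_term_nonneg)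
    have s: "f sums log_series M x y" unfolding f_def using x y M by (intro sums_log_series) auto
    have "- f K0 \<le> (\<Sum>k. - f k)"
      using sum_le_suminf[of "\<lambda>k. - f k" "{K0}"] np s by (auto simp: summable_minus sums_iff)
    also have "\<dots> = - log_series M x y" using sums_minus[OF s] by (simp add: sums_iff)
    finally have 1: "log_series M x y \<le> f K0" by simp
    have tp: "0 < power_term M y (Suc K0)" using y by (simp add: power_term_pos)
    have "ln (x + power_term M y (Suc K0)) \<le> ln (2 * power_term M y (Suc K0))" using x tp by (intro ln_mono) (auto simp: r_def)
    also have "\<dots> = ln 2 + ln (power_term M y (Suc K0))" using tp by (simp add: ln_mult)
    finally have "f K0 \<le> 1 / M ^ Suc K0 * (ln 2 + ln (power_term M y (Suc K0)))"
      unfolding f_def using M by (intro mult_left_mono) auto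
    also have "\<dots> = 1 / M ^ Suc K0 * ln 2 + M ^ Suc K0 * ln (y / real (Suc K0))"
      using weight_ln_power_term[OF M y(1), of "Suc K0"] by (simp only: distrib_left)
    also have "\<dots> \<le> ln 2 + real (Suc K0) * (- ln 2)"
    proof (rule add_mono)
      have "1 \<le> M ^ Suc K0" using M by (intro one_le_power) auto
      then show "1 / M ^ Suc K0 * ln 2 \<le> ln 2" by (simp add: divide_le_eq mult_le_cancel_left1 del: power_Suc)
      have "y / real (Suc K0) \<le> y" using y by (auto simp: divide_le_eq mult_le_cancel_left1)
      then have "ln (y / real (Suc K0)) \<le> ln (1/2)" using y by (intro ln_mono) auto
      then have l: "ln (y / real (Suc K0)) \<le> - ln 2" by (simp add: ln_div)
      have "real (Suc K0) \<le> 2 ^ Suc K0" using of_nat_less_two_power[of "Suc K0"] by (intro less_imp_le)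
      also have "\<dots> \<le> M ^ Suc K0" using M by (intro power_mono) auto
      finally have "real (Suc K0) \<le> M ^ Suc K0" .
      then have "M ^ Suc K0 * (- ln 2) \<le> real (Suc K0) * (- ln 2)" by (simp del: power_Suc of_nat_Suc)
      moreover have "M ^ Suc K0 * ln (y / real (Suc K0)) \<le> M ^ Suc K0 * (- ln 2)"
        using l M by (intro mult_left_mono) auto
      ultimately show "M ^ Suc K0 * ln (y / real (Suc K0)) \<le> real (Suc K0) * (- ln 2)" by linarith
    qed
    also have "\<dots> = - (real K0 * ln 2)" by (simp add: algebra_simps)
    also have "\<dots> \<le> - B" 
    proof -
      have "B + ln 2 < real K0 * ln 2" using K0 by (simp add: pos_divide_less_eq)
      then show ?thesis using ln_gt_zero[of "2::real"] by linarith
    qed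
    finally show "log_series M x y \<le> - B" using 1 by simp
  qed
qed

text \<open>
  Finitely many terms are bounded below on the slice by their values at \<open>x = 0\<close>; each of the others is at least
  its weight times \<open>ln x\<close>, and the weights have a tail of sum less than \<open>\<delta>\<close>.
\<close>

lemma log_series_sublogarithmic:
  assumes M: "M \<ge> 2" and y: "0 < y" and d: "0 < \<delta>"
  obtains C where "\<And>x. 0 < x \<Longrightarrow> x \<le> 1 \<Longrightarrow> \<delta> * ln x - C \<le> log_series M x y"
proof -
  have sw: "summable (\<lambda>k. 1 / M ^ Suc k)" by (rule summable_weights[OF M])
  obtain K where K: "\<bar>\<Sum>k. 1 / M ^ Suc (k + K)\<bar> < \<delta>"
    using suminf_exist_split[OF d sw] by (auto simp del: power_Suc)
  define C where "C = - (\<Sum>k<K. 1 / M ^ Suc k * ln (power_term M y (Suc k)))"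
  show thesis
  proof (rule that)
    fix x :: real assume x: "0 < x" "x \<le> 1"
    define f where "f k = 1 / M ^ Suc k * ln (x + power_term M y (Suc k))" for k
    have s: "f sums log_series M x y" unfolding f_def using x y M by (intro sums_log_series) auto
    have "- C \<le> sum f {..<K}"
      unfolding C_def f_def minus_minus using M x y
      by (intro sum_mono mult_left_mono ln_mono add_pos_pos power_term_pos) auto
    moreover have "(\<Sum>k. 1 / M ^ Suc (k + K)) * ln x \<le> (\<Sum>k. f (k + K))"
    proof -
      have "(\<Sum>k. 1 / M ^ Suc (k + K)) * ln x = (\<Sum>k. 1 / M ^ Suc (k + K) * ln x)"
        using sw summable_iff_shift[of "\<lambda>k. 1 / M ^ Suc k" K] by (intro suminf_mult2) (auto simp del: power_Suc)
      also have "\<dots> \<le> (\<Sum>k. f (k + K))"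
      proof (rule suminf_le)
        fix k show "1 / M ^ Suc (k + K) * ln x \<le> f (k + K)"
          unfolding f_def using M x by (intro mult_left_mono ln_mono) auto
      next
        show "summable (\<lambda>k. 1 / M ^ Suc (k + K) * ln x)"
          using sw summable_iff_shift[of "\<lambda>k. 1 / M ^ Suc k" K] by (intro summable_mult2) (auto simp del: power_Suc)
        show "summable (\<lambda>k. f (k + K))" using s summable_iff_shift[of f K] by (auto simp: sums_iff)
      qed
      finally show ?thesis .
    qed
    moreover have "\<delta> * ln x \<le> (\<Sum>k. 1 / M ^ Suc (k + K)) * ln x"
      using K x by (intro mult_right_mono_neg) (auto simp del: power_Suc)
    moreover have "log_series M x y = (\<Sum>k. f (k + K)) + sum f {..<K}"
      using s suminf_split_initial_segment[of f K] by (auto simp: sums_iff)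
    ultimately show "\<delta> * ln x - C \<le> log_series M x y" by linarith
  qed
qed

section \<open>Values of the potential on and off the hyperplane\<close>

lemma elog_pos: "0 < x \<Longrightarrow> elog x = ereal (ln x)" by (simp add: elog_def)

lemma elog_zero [simp]: "elog 0 = -\<infinity>" by (simp add: elog_def)

lemma elog_le_ln: "x \<le> y \<Longrightarrow> 0 < y \<Longrightarrow> elog x \<le> ereal (ln y)" by (simp add: elog_def)

lemma phi_alt:
  fixes z :: "complex ^ 'n"
  shows
  "phi i1 i2 M z = elog (cmod (z $ i1)) +
     (\<Sum>k. ereal (1 / M ^ Suc k) * elog (cmod (z $ i1) + power_term M (cmod (z $ i2)) (Suc k)))"
  by (simp add: phi_def Let_def power_term_def norm_divide del: power_Suc of_nat_Suc)

lemma phi_off_hyperplane: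
  fixes z :: "complex ^ 'n"
  assumes M: "M \<ge> 2" and z: "z $ i1 \<noteq> 0"
  shows "phi i1 i2 M z = ereal (ln (cmod (z $ i1)) + log_series M (cmod (z $ i1)) (cmod (z $ i2)))"
proof -
  define x y where "x = cmod (z $ i1)" and "y = cmod (z $ i2)"
  have x: "0 < x" "0 \<le> y" using z by (auto simp: x_def y_def)
  have "ereal (1 / M ^ Suc k) * elog (x + power_term M y (Suc k)) = ereal (1 / M ^ Suc k * ln (x + power_term M y (Suc k)))" for k
    using x by (simp add: elog_pos add_pos_nonneg del: power_Suc)
  then have "(\<lambda>k. ereal (1 / M ^ Suc k) * elog (x + power_term M y (Suc k))) sums ereal (log_series M x y)"
    using sums_log_series[OF M x] by (simp add: sums_ereal del: power_Suc)
  then show ?thesis using x by (simp add: phi_alt sums_unique[symmetric] elog_pos flip: x_def y_def del: power_Suc)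
qed

text \<open>
  Convergence to \<open>-\<infinity>\<close> has to be derived from the partial sums, since an \<^typ>\<open>ereal\<close> series of terms
  that may be infinite or of either sign need not be summable.
\<close>

lemma series_MInfty:
  fixes f :: "nat \<Rightarrow> ereal"
  assumes b: "\<And>k. f k \<le> ereal (b k)" and N: "\<And>k. N \<le> k \<Longrightarrow> b k \<le> - c" and c: "0 < c"
  shows "(\<Sum>k. f k) = -\<infinity>"
proof -
  have *: "(\<Sum>k<n + N. f k) \<le> ereal (sum b {..<N} - real n * c)" for n
  proof -
    have "(\<Sum>k<n + N. f k) \<le> (\<Sum>k<n + N. ereal (b k))" by (intro sum_mono b)
    also have "\<dots> = ereal (\<Sum>k<n + N. b k)" by simp
    also have "(\<Sum>k<n + N. b k) \<le> sum b {..<N} - real n * c"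
    proof (induction n)
      case (Suc n) then show ?case using N[of "n+N"] by (simp add: algebra_simps)
    qed simp
    finally show ?thesis by simp
  qed
  have "(\<lambda>n. \<Sum>k<n + N. f k) \<longlonglongrightarrow> -\<infinity>"
    unfolding tendsto_MInfty
  proof
    fix r :: real
    obtain n0 where n0: "(sum b {..<N} - r) / c < real n0" using reals_Archimedean2 by blast
    show "\<forall>\<^sub>F n in sequentially. (\<Sum>k<n + N. f k) < ereal r"
      using eventually_ge_at_top[of n0]
    proof eventually_elim
      case (elim n)
      have "(sum b {..<N} - r) / c < real n" using n0 elim by linarith
      then have "sum b {..<N} - real n * c < r" using c by (simp add: field_simps)
      then show ?case using *[of n] by (meson ereal_less(5) le_less_trans less_ereal.simps(1))
    qed
  qed
  then have "(\<lambda>n. \<Sum>k<n. f k) \<longlonglongrightarrow> -\<infinity>" by (rule LIMSEQ_offset)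
  then show ?thesis by (simp add: sums_unique[symmetric] sums_def)
qed

text \<open>
  Since \<open>-\<infinity> + \<infinity> = \<infinity>\<close> in \<^typ>\<open>ereal\<close>, the first summand alone does not decide the value. The
  terms of the series are at most \<open>M ^ j * ln (y / j)\<close> with \<open>y = \<bar>z\<^sub>2\<bar> + 1\<close>, a shift which
  covers \<open>z\<^sub>2 = 0\<close> too, and these are eventually below \<open>- ln 2\<close>.
\<close>

lemma phi_on_hyperplane:
  fixes z :: "complex ^ 'n"
  assumes M: "M \<ge> 2" and z: "z $ i1 = 0"
  shows "phi i1 i2 M z = -\<infinity>"
proof -
  define y where "y = cmod (z $ i2) + 1"
  obtain N where N: "2 * y \<le> real N" using real_arch_simple by blast
  have y: "1 \<le> y" by (simp add: y_def)
  have "(\<Sum>k. ereal (1 / M ^ Suc k) * elog (power_term M (cmod (z $ i2)) (Suc k))) = -\<infinity>"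
  proof (rule series_MInfty[where N = N and c = "ln 2"])
    fix k
    have "power_term M (cmod (z $ i2)) (Suc k) \<le> power_term M y (Suc k)"
      unfolding power_term_def using M by (intro powr_mono2 divide_right_mono) (auto simp: y_def)
    then have "elog (power_term M (cmod (z $ i2)) (Suc k)) \<le> ereal (ln (power_term M y (Suc k)))"
      using y by (intro elog_le_ln power_term_pos) auto
    then have "ereal (1 / M ^ Suc k) * elog (power_term M (cmod (z $ i2)) (Suc k)) \<le> ereal (1 / M ^ Suc k) * ereal (ln (power_term M y (Suc k)))"
      using M by (intro ereal_mult_left_mono) auto
    then show "ereal (1 / M ^ Suc k) * elog (power_term M (cmod (z $ i2)) (Suc k)) \<le> ereal (1 / M ^ Suc k * ln (power_term M y (Suc k)))"
      by simp
  next
    fix k assume k: "N \<le> k"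
    have "y / real (Suc k) \<le> 1/2" using N k y by (simp add: field_simps)
    moreover have "0 < y / real (Suc k)" using y by simp
    ultimately have "ln (y / real (Suc k)) \<le> ln (1/2)" by (subst ln_le_cancel_iff) auto
    then have l: "ln (y / real (Suc k)) \<le> - ln 2" by (simp add: ln_div)
    have M1: "1 \<le> M ^ Suc k" using M by (intro one_le_power) auto
    have "1 / M ^ Suc k * ln (power_term M y (Suc k)) = M ^ Suc k * ln (y / real (Suc k))"
      using y M by (intro weight_ln_power_term) auto
    also have "\<dots> \<le> M ^ Suc k * (- ln 2)" using l M1 by (intro mult_left_mono) auto
    also have "\<dots> \<le> - ln 2" using mult_right_mono[OF M1, of "ln 2"] by simp
    finally show "1 / M ^ Suc k * ln (power_term M y (Suc k)) \<le> - ln 2" .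
  qed simp
  then show ?thesis using z by (simp add: phi_alt del: power_Suc)
qed

section \<open>Means of logarithms of affine functions over circles\<close>

lemma e2ennreal_ereal: "e2ennreal (ereal r) = ennreal r"
  by (simp add: e2ennreal_def ennreal.abs_eq flip: ereal_max)

text \<open>
  Both nonnegative integrals in the definition of \<^const>\<open>ext_integral\<close> are monotone for arbitrary
  functions, so \<open>u\<close> may be nonmeasurable.
\<close>

lemma ext_integral_lower:
  assumes h: "integrable M h" and le: "AE t in M. ereal (h t) \<le> u t"
  shows "ereal (integral\<^sup>L M h) \<le> ext_integral M u"
proof -
  have p: "(\<integral>\<^sup>+t. ennreal (h t) \<partial>M) \<le> (\<integral>\<^sup>+t. e2ennreal (u t) \<partial>M)"
  proof (rule nn_integral_mono_AE)
    show "AE t in M. ennreal (h t) \<le> e2ennreal (u t)"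
      using le by eventually_elim (simp only: e2ennreal_ereal[symmetric] e2ennreal_mono)
  qed
  have n: "(\<integral>\<^sup>+t. e2ennreal (- u t) \<partial>M) \<le> (\<integral>\<^sup>+t. ennreal (- h t) \<partial>M)"
  proof (rule nn_integral_mono_AE)
    show "AE t in M. e2ennreal (- u t) \<le> ennreal (- h t)"
      using le
    proof eventually_elim
      case (elim t)
      then have "- u t \<le> ereal (- h t)" by (simp only: uminus_ereal.simps(1)[symmetric] ereal_minus_le_minus)
      then show ?case unfolding e2ennreal_ereal[symmetric] by (rule e2ennreal_mono)
    qed
  qed
  have f: "(\<integral>\<^sup>+t. ennreal (h t) \<partial>M) < \<infinity>" "(\<integral>\<^sup>+t. ennreal (- h t) \<partial>M) < \<infinity>"
    using h by (auto simp: real_integrable_def top.not_eq_extremum)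
  have "ereal (integral\<^sup>L M h) = enn2ereal (\<integral>\<^sup>+t. ennreal (h t) \<partial>M) - enn2ereal (\<integral>\<^sup>+t. ennreal (- h t) \<partial>M)"
  proof -
    obtain a where "(\<integral>\<^sup>+t. ennreal (h t) \<partial>M) = ennreal a" "0 \<le> a"
      using f(1) by (cases "\<integral>\<^sup>+t. ennreal (h t) \<partial>M" rule: ennreal_cases) auto
    moreover obtain b where "(\<integral>\<^sup>+t. ennreal (- h t) \<partial>M) = ennreal b" "0 \<le> b"
      using f(2) by (cases "\<integral>\<^sup>+t. ennreal (- h t) \<partial>M" rule: ennreal_cases) auto
    ultimately show ?thesis using real_lebesgue_integral_def[OF h] by (simp add: enn2ereal_ennreal)
  qed
  also have "\<dots> \<le> ext_integral M u"
    unfolding ext_integral_def using p n by (intro ereal_minus_mono) (auto simp: less_eq_ennreal.rep_eq)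
  finally show ?thesis .
qed

abbreviation "angles \<equiv> lebesgue_on {0..2*pi}"

text \<open>
  On the closed unit disc \<open>1 + (d/c) u\<close> has positive real part, so its principal logarithm is holomorphic.
  The real part of that logarithm is \<open>ln \<bar>c + d u\<bar> - ln \<bar>c\<bar>\<close>, and Cauchy's formula at 0 shows that its mean is 0.
\<close>

lemma ln_cmod_circle_mean_outside:
  assumes "cmod d < cmod c"
  shows "integrable angles (\<lambda>t. ln (cmod (c + d * cis t)))"
    and "integral\<^sup>L angles (\<lambda>t. ln (cmod (c + d * cis t))) = 2 * pi * ln (cmod c)"
proof -
  have c: "c \<noteq> 0" using assms by auto
  have nz: "c + d * cis t \<noteq> 0" for t
  proof
    assume "c + d * cis t = 0"
    then have "c = - (d * cis t)" by (simp add: add_eq_0_iff2)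
    then have "cmod c = cmod d" by (simp add: norm_mult)
    with assms show False by simp
  qed
  have cont: "continuous_on {0..2*pi} (\<lambda>t. ln (cmod (c + d * cis t)))"
    using nz by (intro continuous_intros) auto
  show int: "integrable angles (\<lambda>t. ln (cmod (c + d * cis t)))"
    by (intro continuous_imp_integrable_real cont)
  define f where "f = (\<lambda>u. Ln (1 + d / c * u))"
  have re: "0 < Re (1 + d / c * u)" if "cmod u \<le> 1" for u
  proof -
    have "cmod (d / c * u) \<le> cmod (d / c) * 1" unfolding norm_mult using that by (intro mult_left_mono) auto
    also have "\<dots> < 1" using assms c by (simp add: norm_divide divide_less_eq)
    finally show ?thesis using abs_Re_le_cmod[of "d / c * u"] by simp
  qed
  have "f holomorphic_on cball 0 1"
    unfolding f_def
  proof (intro holomorphic_intros)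
    fix u :: complex assume "u \<in> cball 0 1"
    then show "1 + d / c * u \<notin> \<real>\<^sub>\<le>\<^sub>0" using re[of u] by (auto simp: complex_nonpos_Reals_iff)
  qed
  from Cauchy_integral_circlepath_simple[OF this, of 0]
  have "((\<lambda>u. f u / u) has_contour_integral 0) (part_circlepath 0 1 0 (2*pi))"
    by (simp add: f_def circlepath_def)
  then have "((\<lambda>t. f (cis t) / cis t * \<i> * cis t) has_integral 0) {0..2*pi}"
    by (subst (asm) has_contour_integral_part_circlepath_iff) auto
  then have "((\<lambda>t. f (cis t) * \<i>) has_integral 0) {0..2*pi}" by (simp add: mult.assoc)
  from has_integral_linear[OF this bounded_linear_Im]
  have "((\<lambda>t. Re (f (cis t))) has_integral 0) {0..2*pi}" by (simp add: o_def)
  from has_integral_add[OF has_integral_const_real[of "ln (cmod c)"] this]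
  have "((\<lambda>t. ln (cmod c) + Re (f (cis t))) has_integral 2 * pi * ln (cmod c)) {0..2*pi}" by simp
  moreover have "ln (cmod c) + Re (f (cis t)) = ln (cmod (c + d * cis t))" for t
  proof -
    have ne: "1 + d / c * cis t \<noteq> 0"
    proof
      assume eq: "1 + d / c * cis t = 0"
      have "0 < Re (1 + d / c * cis t)" by (rule re) simp
      then show False unfolding eq by simp
    qed
    have "c + d * cis t = c * (1 + d / c * cis t)" using c by (simp add: field_simps)
    then have "cmod (c + d * cis t) = cmod c * cmod (1 + d / c * cis t)" by (simp add: norm_mult)
    then show ?thesis using c ne by (simp add: f_def ln_mult)
  qed
  ultimately have "((\<lambda>t. ln (cmod (c + d * cis t))) has_integral 2 * pi * ln (cmod c)) {0..2*pi}" by simp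
  moreover have "((\<lambda>t. ln (cmod (c + d * cis t))) has_integral integral\<^sup>L angles (\<lambda>t. ln (cmod (c + d * cis t)))) {0..2*pi}"
    by (intro has_integral_integral_lebesgue_on int) auto
  ultimately show "integral\<^sup>L angles (\<lambda>t. ln (cmod (c + d * cis t))) = 2 * pi * ln (cmod c)"
    by (rule has_integral_unique[symmetric])
qed

lemma circle_line_AE_nonzero:
  assumes "c \<noteq> 0"
  shows "AE t in angles. c + d * cis t \<noteq> 0"
proof -
  define S where "S = {t\<in>{0..2*pi}. c + d * cis t = 0}"
  have "S \<subseteq> {2*pi, Arg2pi (- c / d)}"
  proof
    fix t assume "t \<in> S"
    then have eq: "c + d * cis t = 0" and r: "0 \<le> t" "t \<le> 2*pi" by (simp_all add: S_def)
    have d: "d \<noteq> 0" using eq assms by auto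
    have "d * cis t = - c" using eq by (metis add_eq_0_iff)
    then have ct: "cis t = - c / d" using d by (metis nonzero_mult_div_cancel_left)
    show "t \<in> {2*pi, Arg2pi (- c / d)}"
    proof (cases "t = 2*pi")
      case False
      have "Arg2pi (- c / d) = t"
      proof (rule Arg2pi_unique)
        show "of_real 1 * exp (\<i> * of_real t) = - c / d"
          by (simp only: ct[symmetric] cis_conv_exp of_real_1 mult_1_left)
      qed (use False r in auto)
      then show ?thesis by blast
    qed simp
  qed
  then have "finite S" by (rule finite_subset) simp
  then have "S \<in> null_sets lebesgue" by (intro null_sets_completionI finite_imp_null_set_lborel)
  then have "AE t in lebesgue. t \<notin> S" by (rule AE_not_in)
  then have "AE t in lebesgue. t \<in> {0..2*pi} \<longrightarrow> c + d * cis t \<noteq> 0"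
    by (rule eventually_mono) (simp add: S_def)
  then show ?thesis by (subst AE_restrict_space_iff) simp_all
qed

text \<open>
  Here the affine function has a zero on the circle. Moving this zero slightly outwards, which
  replaces \<open>d\<close> by \<open>n d / (n + 1)\<close>, leaves the logarithms below the common bound \<open>ln (2 \<bar>c\<bar>)\<close> and their means
  equal to \<open>ln \<bar>c\<bar>\<close>; Fatou's lemma for the distance to the bound then gives integrability and the inequality.
\<close>

lemma ln_cmod_circle_mean_on:
  assumes cd: "cmod d = cmod c" and c: "c \<noteq> 0"
  shows "integrable angles (\<lambda>t. ln (cmod (c + d * cis t)))"
    and "integral\<^sup>L angles (\<lambda>t. ln (cmod (c + d * cis t))) \<ge> 2 * pi * ln (cmod c)"
proof -
  define d' where "d' n = of_real (real n / real (Suc n)) * d" for n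
  define h where "h t = ln (cmod (c + d * cis t))" for t
  define hn where "hn n t = ln (cmod (c + d' n * cis t))" for n t
  define B where "B = ln (2 * cmod c)"
  have d0: "d \<noteq> 0" using cd c by auto
  have d'lt: "cmod (d' n) < cmod c" for n
  proof -
    have "cmod (d' n) = real n / real (Suc n) * cmod c"
      unfolding d'_def norm_mult norm_of_real cd by simp
    then show ?thesis using c by (simp add: divide_less_eq algebra_simps)
  qed
  have "(\<lambda>t. ln (cmod (c + e * cis t))) \<in> borel_measurable angles" for e
  proof -
    have "(\<lambda>t. cmod (c + e * cis t)) \<in> borel_measurable borel"
      by (intro borel_measurable_continuous_onI continuous_intros)
    then have "(\<lambda>t. ln (cmod (c + e * cis t))) \<in> borel_measurable lborel" by simp
    then show ?thesis by (intro measurable_restrict_space1 measurable_completion)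
  qed
  then have meas: "h \<in> borel_measurable angles" "hn n \<in> borel_measurable angles" for n
    unfolding h_def hn_def by blast+
  have lim: "AE t in angles. (\<lambda>n. hn n t) \<longlonglongrightarrow> h t"
    using circle_line_AE_nonzero[OF c, of d]
  proof eventually_elim
    case (elim t)
    have "(\<lambda>n. complex_of_real (real n / real (Suc n))) \<longlonglongrightarrow> of_real 1"
      by (intro tendsto_of_real LIMSEQ_n_over_Suc_n)
    from tendsto_mult[OF this tendsto_const[of d]]
    have "d' \<longlonglongrightarrow> d" unfolding d'_def by simp
    then show ?case unfolding hn_def h_def using elim by (intro tendsto_intros) auto
  qed
  have bn: "hn n t \<le> B" for n t
  proof -
    have "cmod (c + d' n * cis t) \<le> cmod c + cmod (d' n * cis t)" by (rule norm_triangle_ineq)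
    also have "\<dots> \<le> 2 * cmod c" using d'lt[of n] by (simp add: norm_mult)
    finally have le: "cmod (c + d' n * cis t) \<le> 2 * cmod c" .
    have "cmod (d' n * cis t) < cmod c" using d'lt[of n] by (simp add: norm_mult)
    then have "c \<noteq> - (d' n * cis t)" by (metis less_irrefl norm_minus_cancel)
    then have "0 < cmod (c + d' n * cis t)" by (simp add: add_eq_0_iff2)
    with le show ?thesis unfolding hn_def B_def by (intro ln_mono)
  qed
  have In: "integrable angles (hn n)" "integral\<^sup>L angles (hn n) = 2 * pi * ln (cmod c)" for n
    unfolding hn_def by (intro ln_cmod_circle_mean_outside d'lt)+
  have fin: "finite_measure angles" by (intro finite_measure_lebesgue_on) auto
  interpret finite_measure angles by (rule fin)
  have mc: "measure angles (space angles) = 2 * pi" by (simp add: measure_restrict_space)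
  have "(\<integral>\<^sup>+t. ennreal (B - h t) \<partial>angles) \<le> liminf (\<lambda>n. \<integral>\<^sup>+t. ennreal (B - hn n t) \<partial>angles)"
  proof -
    have "(\<integral>\<^sup>+t. ennreal (B - h t) \<partial>angles) = (\<integral>\<^sup>+t. liminf (\<lambda>n. ennreal (B - hn n t)) \<partial>angles)"
    proof (rule nn_integral_cong_AE)
      show "AE t in angles. ennreal (B - h t) = liminf (\<lambda>n. ennreal (B - hn n t))"
        using lim
      proof eventually_elim
        case (elim t)
        have "(\<lambda>n. ennreal (B - hn n t)) \<longlonglongrightarrow> ennreal (B - h t)" by (intro tendsto_intros elim)
        then show ?case by (simp add: lim_imp_Liminf)
      qed
    qed
    also have "\<dots> \<le> liminf (\<lambda>n. \<integral>\<^sup>+t. ennreal (B - hn n t) \<partial>angles)"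
      using meas by (intro nn_integral_liminf) auto
    finally show ?thesis .
  qed
  also have "\<dots> = ennreal (2 * pi * (B - ln (cmod c)))"
  proof -
    have "(\<integral>\<^sup>+t. ennreal (B - hn n t) \<partial>angles) = ennreal (2 * pi * (B - ln (cmod c)))" for n
      using bn In[of n] mc
      by (subst nn_integral_eq_integral) (auto simp: algebra_simps intro!: integrable_const)
    then show ?thesis by (simp add: Liminf_const)
  qed
  finally have F: "(\<integral>\<^sup>+t. ennreal (B - h t) \<partial>angles) \<le> ennreal (2 * pi * (B - ln (cmod c)))" .
  have Bh: "AE t in angles. 0 \<le> B - h t"
    using lim
  proof eventually_elim
    case (elim t)
    have "h t \<le> B" by (rule LIMSEQ_le_const2[OF elim]) (use bn in blast)
    then show ?case by simp
  qed
  have I: "integrable angles (\<lambda>t. B - h t)"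
    using le_less_trans[OF F] meas Bh by (intro integrableI_nonneg) auto
  from Bochner_Integration.integrable_diff[OF integrable_const[of B] this]
  show Ih: "integrable angles h" by simp
  have "0 \<le> B - ln (cmod c)" using c by (simp add: B_def ln_mult)
  moreover have "ennreal (integral\<^sup>L angles (\<lambda>t. B - h t)) \<le> ennreal (2 * pi * (B - ln (cmod c)))"
    using F nn_integral_eq_integral[OF I Bh] by simp
  ultimately have "integral\<^sup>L angles (\<lambda>t. B - h t) \<le> 2 * pi * (B - ln (cmod c))"
    by (subst (asm) ennreal_le_iff) auto
  then show "integral\<^sup>L angles h \<ge> 2 * pi * ln (cmod c)"
    using Ih mc by (simp add: algebra_simps)
qed

text \<open>
  If the zero lies inside the disc, reflect it: on the unit circle \<open>\<bar>c + d u\<bar> = \<bar>cnj d + cnj c * u\<bar>\<close>, and the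
  mean is \<open>ln \<bar>d\<bar> > ln \<bar>c\<bar>\<close>.
\<close>

lemma ln_cmod_circle_submean:
  assumes c: "c \<noteq> 0"
  shows "integrable angles (\<lambda>t. ln (cmod (c + d * cis t)))"
    and "integral\<^sup>L angles (\<lambda>t. ln (cmod (c + d * cis t))) \<ge> 2 * pi * ln (cmod c)"
proof -
  have *: "integrable angles (\<lambda>t. ln (cmod (c + d * cis t))) \<and>
    integral\<^sup>L angles (\<lambda>t. ln (cmod (c + d * cis t))) \<ge> 2 * pi * ln (cmod c)"
  proof (cases "cmod c" "cmod d" rule: linorder_cases)
    case less
    have eq: "cmod (c + d * cis t) = cmod (cnj d + cnj c * cis t)" for t
    proof -
      have "cmod (c + d * cis t) = cmod (cnj (c + d * cis t) * cis t)"
        by (simp only: norm_mult norm_cis complex_mod_cnj mult_1_right)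
      also have "cnj (c + d * cis t) * cis t = cnj d * (cis (-t) * cis t) + cnj c * cis t"
        by (simp add: algebra_simps cis_cnj)
      also have "cis (-t) * cis t = 1" by (simp add: cis_mult)
      finally show ?thesis by simp
    qed
    have "ln (cmod c) \<le> ln (cmod d)" using less c by (intro ln_mono) auto
    then show ?thesis unfolding eq using ln_cmod_circle_mean_outside[of "cnj c" "cnj d"] less by simp
  qed (use ln_cmod_circle_mean_outside[of d c] ln_cmod_circle_mean_on[of d c] c in auto)
  from * show "integrable angles (\<lambda>t. ln (cmod (c + d * cis t)))"
    and "integral\<^sup>L angles (\<lambda>t. ln (cmod (c + d * cis t))) \<ge> 2 * pi * ln (cmod c)" by auto
qed

section \<open>Plurisubharmonicity of the potential\<close>

lemma power_term_mono: "M \<ge> 2 \<Longrightarrow> 0 \<le> y \<Longrightarrow> y \<le> y' \<Longrightarrow> power_term M y j \<le> power_term M y' j"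
  unfolding power_term_def by (intro powr_mono2 divide_right_mono) auto

lemma log_series_mono:
  assumes M: "M \<ge> 2" and x: "0 < x" "x \<le> x'" and y: "0 \<le> y" "y \<le> y'"
  shows "log_series M x y \<le> log_series M x' y'"
proof (rule sums_le)
  show "(\<lambda>k. 1 / M ^ Suc k * ln (x + power_term M y (Suc k))) sums log_series M x y"
       "(\<lambda>k. 1 / M ^ Suc k * ln (x' + power_term M y' (Suc k))) sums log_series M x' y'"
    by (intro sums_log_series; use assms in linarith)+
  show "1 / M ^ Suc k * ln (x + power_term M y (Suc k)) \<le> 1 / M ^ Suc k * ln (x' + power_term M y' (Suc k))" for k
    using assms by (intro mult_left_mono ln_mono add_mono power_term_mono add_pos_nonneg) auto
qed

text \<open>
  Upper semicontinuity. Off the hyperplane \<open>\<phi>\<close> is continuous; near a point of the hyperplane the series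
  is bounded above by its value at \<open>(1, R)\<close> for some \<open>R\<close>, and \<open>ln \<bar>z\<^sub>1\<bar>\<close> tends to \<open>-\<infinity>\<close>.
\<close>

lemma phi_eventually_less:
  fixes z :: "complex ^ 'n"
  assumes M: "M \<ge> 2" and c: "phi i1 i2 M z < c"
  shows "\<forall>\<^sub>F y in nhds z. phi i1 i2 M y < c"
proof (cases "z $ i1 = 0")
  case False
  define F where "F y = ln (cmod (y $ i1)) + log_series M (cmod (y $ i1)) (cmod (y $ i2))" for y :: "complex ^ 'n"
  have op: "open {y :: complex ^ 'n. y $ i1 \<noteq> 0}"
    by (intro open_Collect_neq continuous_intros)
  have "continuous_on {y. y $ i1 \<noteq> 0} (\<lambda>y :: complex ^ 'n. log_series M (cmod (y $ i1)) (cmod (y $ i2)))"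
    using continuous_on_compose2[OF continuous_on_log_series[OF M],
        of "{y. y $ i1 \<noteq> 0}" "\<lambda>y. (cmod (y $ i1), cmod (y $ i2))"]
    by (fastforce intro!: continuous_intros)
  then have "continuous_on {y. y $ i1 \<noteq> 0} F"
    unfolding F_def by (intro continuous_intros) auto
  then have "isCont F z" using op False by (auto simp: continuous_on_eq_continuous_at)
  then have "(F \<longlongrightarrow> F z) (nhds z)" by (simp add: tendsto_nhds_iff isCont_def)
  then have "((\<lambda>y. ereal (F y)) \<longlongrightarrow> ereal (F z)) (nhds z)" by (rule tendsto_ereal)
  moreover have "ereal (F z) < c" using c phi_off_hyperplane[OF M False] by (simp add: F_def)
  ultimately have "\<forall>\<^sub>F y in nhds z. ereal (F y) < c" by (rule order_tendstoD)
  moreover have "\<forall>\<^sub>F y in nhds z. y $ i1 \<noteq> 0"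
    using eventually_nhds_in_open[OF op, of z] False by simp
  ultimately show ?thesis
    by eventually_elim (simp add: phi_off_hyperplane[OF M] F_def)
next
  case True
  have cm: "c \<noteq> -\<infinity>" using c by auto
  then obtain r where r: "ereal r \<le> c" by (cases c) (auto intro: order_refl)
  define R where "R = cmod (z $ i2) + 1"
  define d where "d = min 1 (exp (r - log_series M 1 R))"
  have "\<forall>\<^sub>F y :: complex ^ 'n in nhds z. cmod (y $ i1) < d"
    using True by (intro order_tendstoD(2)[where y = "cmod (z $ i1)"] tendsto_intros) (auto simp: d_def filterlim_ident)
  moreover have "\<forall>\<^sub>F y :: complex ^ 'n in nhds z. cmod (y $ i2) < R"
    by (intro order_tendstoD(2)[where y = "cmod (z $ i2)"] tendsto_intros) (auto simp: R_def filterlim_ident)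
  ultimately show ?thesis
  proof eventually_elim
    case (elim y)
    show ?case
    proof (cases "y $ i1 = 0")
      case True
      then show ?thesis using phi_on_hyperplane[OF M, of y i1 i2] cm by simp
    next
      case False
      have "log_series M (cmod (y $ i1)) (cmod (y $ i2)) \<le> log_series M 1 R"
        using elim False M by (intro log_series_mono) (auto simp: d_def)
      moreover have "ln (cmod (y $ i1)) < ln (exp (r - log_series M 1 R))"
        using elim(1) False by (intro ln_strict_mono) (auto simp: d_def)
      then have "ln (cmod (y $ i1)) < r - log_series M 1 R" by simp
      ultimately have "ln (cmod (y $ i1)) + log_series M (cmod (y $ i1)) (cmod (y $ i2)) < r" by linarith
      then have "phi i1 i2 M y < ereal r" using False by (simp add: phi_off_hyperplane[OF M])
      then show ?thesis using r by (rule less_le_trans)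
    qed
  qed
qed

lemma phi_not_top:
  fixes z :: "complex ^ 'n"
  assumes M: "M \<ge> 2" shows "phi i1 i2 M z \<noteq> \<infinity>"
  by (cases "z $ i1 = 0") (simp_all add: phi_on_hyperplane[OF M] phi_off_hyperplane[OF M])

text \<open>
  The tangent plane at the centre, composed with the moduli of the coordinates along the circle, is an integrable
  minorant \<open>h\<close> that agrees with \<open>\<phi>\<close> at the centre and whose mean is at least its central value. It is a
  minorant where the first coordinate does not vanish and, if \<open>y0 \<noteq> 0\<close>, the second one does not either. These
  affine functions are nonzero at the centre, so this is almost everywhere on the circle.
\<close>

lemma phi_circle_submean:
  fixes p c :: "complex ^ 'n"
  assumes M: "M \<ge> 2"
  shows "phi i1 i2 M p \<le> ereal (1 / (2 * pi)) * ext_integral angles (\<lambda>t. phi i1 i2 M (p + cis t *s c))"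
proof (cases "p $ i1 = 0")
  case False
  define x0 y0 where "x0 = cmod (p $ i1)" and "y0 = cmod (p $ i2)"
  define x y where "x t = cmod (p $ i1 + c $ i1 * cis t)" and "y t = cmod (p $ i2 + c $ i2 * cis t)" for t
  have x0: "0 < x0" "0 \<le> y0" using False by (auto simp: x0_def y0_def)
  obtain P Q where PQ: "0 \<le> P" "0 \<le> Q"
    "\<And>x y. 0 < x \<Longrightarrow> 0 \<le> y \<Longrightarrow> y0 = 0 \<or> 0 < y \<Longrightarrow>
       log_series M x y \<ge> log_series M x0 y0 + P * (ln x - ln x0) + (if y0 = 0 then 0 else Q * (ln y - ln y0))"
    using log_series_tangent[OF M x0] by metis
  define S where "S t = (if y0 = 0 then 0 else Q * (ln (y t) - ln y0))" for t
  define h where "h t = (ln x0 + log_series M x0 y0) + (1 + P) * (ln (x t) - ln x0) + S t" for t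
  have "finite_measure angles" by (intro finite_measure_lebesgue_on) auto
  then interpret finite_measure angles .
  have mc: "measure angles (space angles) = 2 * pi" by (simp add: measure_restrict_space)
  have Ix: "integrable angles (\<lambda>t. ln (x t) - ln x0)" "0 \<le> integral\<^sup>L angles (\<lambda>t. ln (x t) - ln x0)"
    using ln_cmod_circle_submean[OF False, of "c $ i1"] mc by (simp_all add: x_def x0_def)
  have IS: "integrable angles S \<and> 0 \<le> integral\<^sup>L angles S"
  proof (cases "y0 = 0")
    case False
    then have "p $ i2 \<noteq> 0" by (simp add: y0_def)
    from ln_cmod_circle_submean[OF this, of "c $ i2"] mc
    have "integrable angles (\<lambda>t. ln (y t) - ln y0)" "0 \<le> integral\<^sup>L angles (\<lambda>t. ln (y t) - ln y0)"
      by (simp_all add: y_def y0_def)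
    moreover have "S = (\<lambda>t. Q * (ln (y t) - ln y0))" using False by (auto simp: S_def)
    ultimately show ?thesis using PQ(2) by simp
  next
    case True
    then have "S = (\<lambda>t. 0)" by (auto simp: S_def)
    then show ?thesis by simp
  qed
  have Ih: "integrable angles h" unfolding h_def using Ix IS by simp
  have "integral\<^sup>L angles h = 2 * pi * (ln x0 + log_series M x0 y0)
      + (1 + P) * integral\<^sup>L angles (\<lambda>t. ln (x t) - ln x0) + integral\<^sup>L angles S"
    unfolding h_def using Ix IS mc by simp
  then have lower: "2 * pi * (ln x0 + log_series M x0 y0) \<le> integral\<^sup>L angles h"
    using Ix IS PQ(1) by simp
  have AEx: "AE t in angles. p $ i1 + c $ i1 * cis t \<noteq> 0" by (rule circle_line_AE_nonzero[OF False])
  have AEy: "AE t in angles. y0 = 0 \<or> p $ i2 + c $ i2 * cis t \<noteq> 0"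
  proof (cases "y0 = 0")
    case False
    then have "AE t in angles. p $ i2 + c $ i2 * cis t \<noteq> 0" by (intro circle_line_AE_nonzero) (simp add: y0_def)
    then show ?thesis by eventually_elim simp
  qed simp
  have "AE t in angles. ereal (h t) \<le> phi i1 i2 M (p + cis t *s c)"
    using AEx AEy
  proof eventually_elim
    case (elim t)
    have pos: "0 < x t" "0 \<le> y t" "y0 = 0 \<or> 0 < y t" using elim by (auto simp: x_def y_def)
    have nz: "(p + cis t *s c) $ i1 \<noteq> 0" using elim(1) by (simp add: mult.commute)
    have xy: "cmod ((p + cis t *s c) $ i1) = x t" "cmod ((p + cis t *s c) $ i2) = y t"
      by (simp_all add: x_def y_def mult.commute)
    have "h t \<le> ln (x t) + log_series M (x t) (y t)"
      using PQ(3)[OF pos] by (simp add: h_def S_def algebra_simps split: if_splits)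
    then show ?case unfolding phi_off_hyperplane[OF M nz] xy by simp
  qed
  from ext_integral_lower[OF Ih this] lower
  have "ereal (2 * pi * (ln x0 + log_series M x0 y0)) \<le> ext_integral angles (\<lambda>t. phi i1 i2 M (p + cis t *s c))"
    by (meson ereal_less_eq(3) order_trans)
  then have "ereal (1 / (2 * pi)) * ereal (2 * pi * (ln x0 + log_series M x0 y0))
      \<le> ereal (1 / (2 * pi)) * ext_integral angles (\<lambda>t. phi i1 i2 M (p + cis t *s c))"
    by (intro ereal_mult_left_mono) auto
  then show ?thesis unfolding phi_off_hyperplane[OF M False] by (simp add: x0_def y0_def)
qed (simp add: phi_on_hyperplane[OF M])

lemma plurisubharmonic_phi:
  assumes M: "M \<ge> 2"
  shows "plurisubharmonic_on UNIV (phi i1 i2 M :: complex ^ 'n \<Rightarrow> ereal)"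
  unfolding plurisubharmonic_on_def subharmonic_on_def upper_semicontinuous_on_def
proof (intro conjI ballI allI impI)
  fix z :: "complex ^ 'n" and c assume "phi i1 i2 M z < c"
  from phi_eventually_less[OF M this] show "\<forall>\<^sub>F y in at z. phi i1 i2 M y < c"
    by (simp add: eventually_at_filter eventually_mono)
next
  fix a b :: "complex ^ 'n" and w c assume "phi i1 i2 M (a + w *s b) < c"
  from phi_eventually_less[OF M this]
  have ev: "\<forall>\<^sub>F y in nhds (a + w *s b). phi i1 i2 M y < c" .
  have "continuous_on UNIV (\<lambda>w. a + w *s b)"
    unfolding vector_scalar_mult_def by (intro continuous_intros)
  then have "((\<lambda>w. a + w *s b) \<longlongrightarrow> a + w *s b) (at w)" by (simp add: continuous_on_def)
  from eventually_compose_filterlim[OF ev this]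
  show "\<forall>\<^sub>F w in at w within {w. a + w *s b \<in> UNIV}. phi i1 i2 M (a + w *s b) < c" by simp
next
  fix a b :: "complex ^ 'n" and w :: complex and r :: real
  show "phi i1 i2 M (a + w *s b) \<le> ereal (1 / (2 * pi)) *
          ext_integral angles (\<lambda>t. phi i1 i2 M (a + (w + complex_of_real r * cis t) *s b))"
  proof -
    have "a + (w + complex_of_real r * cis t) *s b = a + w *s b + cis t *s (of_real r *s b)" for t
      by (simp add: vec_eq_iff algebra_simps)
    then show ?thesis using phi_circle_submean[OF M, of i1 i2 "a + w *s b" "of_real r *s b"] by (simp only:)
  qed
qed (simp_all add: phi_not_top[OF M])

section \<open>Integrability on almost every parallel line\<close>

text \<open>
  The integral is invariant under scaling: every annulus \<open>r/2 \<le> \<bar>w\<bar> < r\<close> contributes at least the same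
  positive constant, whatever \<open>r\<close> is.
\<close>

lemma nn_integral_inverse_square_ball:
  assumes "0 < r"
  shows "(\<integral>\<^sup>+w. ennreal (1 / (cmod w)\<^sup>2) * indicator (ball 0 r) w \<partial>lborel) = \<infinity>"
proof -
  define I where "I r = (\<integral>\<^sup>+w. ennreal (1 / (cmod w)\<^sup>2) * indicator (ball 0 r) w \<partial>lborel)" for r
  define v where "v = unit_ball_vol (real DIM(complex))"
  have v: "0 < v" by (simp add: v_def unit_ball_vol_pos)
  have annulus: "I (r/2) + ennreal (3/4 * v) \<le> I r" if r: "0 < r" for r
  proof -
    have [measurable]: "ball (0::complex) s \<in> sets borel" for s by simp
    have "emeasure lborel (ball (0::complex) r - ball 0 (r/2)) = ennreal (v * r^2) - ennreal (v * (r/2)^2)"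
      using r by (subst emeasure_Diff) (auto simp: emeasure_ball v_def)
    also have "\<dots> = ennreal (3/4 * v * r^2)"
      using v r by (subst ennreal_minus) (auto simp: power2_eq_square)
    finally have m: "emeasure lborel (ball (0::complex) r - ball 0 (r/2)) = ennreal (3/4 * v * r^2)" .
    have "ennreal (3/4 * v) = ennreal (1 / r^2) * emeasure lborel (ball (0::complex) r - ball 0 (r/2))"
      unfolding m using v r by (subst ennreal_mult[symmetric]) auto
    also have "\<dots> = (\<integral>\<^sup>+w. ennreal (1 / r^2) * indicator (ball (0::complex) r - ball 0 (r/2)) w \<partial>lborel)"
      by (subst nn_integral_cmult_indicator) auto
    finally have eq: "ennreal (3/4 * v) = (\<integral>\<^sup>+w. ennreal (1 / r^2) * indicator (ball (0::complex) r - ball 0 (r/2)) w \<partial>lborel)" .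
    have m: "(\<lambda>w. ennreal (1 / (cmod w)\<^sup>2) * indicator (ball 0 (r/2)) w) \<in> borel_measurable lborel"
      "(\<lambda>w. ennreal (1 / r^2) * indicator (ball (0::complex) r - ball 0 (r/2)) w) \<in> borel_measurable lborel"
      by measurable
    have "I (r/2) + ennreal (3/4 * v) = (\<integral>\<^sup>+w. ennreal (1 / (cmod w)\<^sup>2) * indicator (ball 0 (r/2)) w
        + ennreal (1 / r^2) * indicator (ball (0::complex) r - ball 0 (r/2)) w \<partial>lborel)"
      unfolding I_def eq by (rule nn_integral_add[OF m, symmetric])
    also have "\<dots> \<le> I r"
      unfolding I_def
    proof (intro nn_integral_mono)
      fix w :: complex
      show "ennreal (1 / (cmod w)\<^sup>2) * indicator (ball 0 (r/2)) w
        + ennreal (1 / r^2) * indicator (ball (0::complex) r - ball 0 (r/2)) w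
        \<le> ennreal (1 / (cmod w)\<^sup>2) * indicator (ball 0 r) w"
      proof (cases "cmod w < r/2")
        case True
        then show ?thesis using r by (auto simp: indicator_def)
      next
        case False
        then have "0 < cmod w" using r by linarith
        have "1 / r^2 \<le> 1 / (cmod w)\<^sup>2" if "cmod w < r"
          using that \<open>0 < cmod w\<close> r by (intro divide_left_mono power_mono mult_pos_pos) auto
        then show ?thesis using False by (auto simp: indicator_def intro!: ennreal_leI)
      qed
    qed
    finally show ?thesis .
  qed
  have "of_nat n * ennreal (3/4 * v) \<le> I r" if "0 < r" for n r
    using that
  proof (induction n arbitrary: r)
    case (Suc n)
    have "of_nat (Suc n) * ennreal (3/4 * v) = of_nat n * ennreal (3/4 * v) + ennreal (3/4 * v)"
      by (simp add: algebra_simps)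
    also have "\<dots> \<le> I (r/2) + ennreal (3/4 * v)" using Suc by (intro add_right_mono) auto
    also have "\<dots> \<le> I r" by (rule annulus[OF Suc.prems])
    finally show ?case .
  qed simp
  then have le: "of_nat n * ennreal (3/4 * v) \<le> I r" for n using assms by blast
  have "I r = \<infinity>"
  proof (cases "I r" rule: ennreal_cases)
    case (real a)
    obtain n where n: "a / (3/4 * v) < real n" using reals_Archimedean2 by blast
    have "ennreal (real n * (3/4 * v)) \<le> ennreal a"
      using le[of n] v unfolding real ennreal_of_nat_eq_real_of_nat by (subst ennreal_mult) auto
    then have "real n * (3/4 * v) \<le> a" using real by (subst (asm) ennreal_le_iff) auto
    with n v show ?thesis by (simp add: divide_less_eq)
  qed simp
  then show ?thesis by (simp add: I_def)
qed

text \<open>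
  A Borel representative agrees with \<open>f\<close> only almost everywhere, which would say nothing about a particular
  line. Raising it to \<open>\<infinity>\<close> on a Borel null set makes it a majorant everywhere at no cost for the integral.
\<close>

lemma lebesgue_measurable_borel_majorant:
  fixes f :: "'a::euclidean_space \<Rightarrow> ennreal"
  assumes f: "f \<in> borel_measurable lebesgue"
  obtains h where "h \<in> borel_measurable borel" "\<And>x. f x \<le> h x" "(\<integral>\<^sup>+x. h x \<partial>lborel) = (\<integral>\<^sup>+x. f x \<partial>lebesgue)"
proof -
  obtain g where g: "g \<in> borel_measurable lborel" "AE x in lborel. f x = g x"
    using completion_ex_borel_measurable[OF f] by blast
  from g(2) obtain N where N: "N \<in> null_sets lborel" "{x\<in>space lborel. f x \<noteq> g x} \<subseteq> N"
    by (auto elim!: AE_E simp: null_sets_def)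
  define h where "h x = g x + \<infinity> * indicator N x" for x
  have gb: "g \<in> borel_measurable borel" using g(1) by simp
  have Nb: "N \<in> sets borel" using N(1) by (auto simp: null_sets_def)
  show thesis
  proof (rule that)
    show "h \<in> borel_measurable borel" unfolding h_def using gb Nb by measurable
    show "f x \<le> h x" for x using N(2) by (cases "x \<in> N"; cases "f x = g x") (auto simp: h_def)
    have "AE x in lborel. h x = f x"
      using AE_not_in[OF N(1)] g(2) by eventually_elim (simp add: h_def)
    then have "(\<integral>\<^sup>+x. h x \<partial>lborel) = (\<integral>\<^sup>+x. f x \<partial>lborel)" by (rule nn_integral_cong_AE)
    then show "(\<integral>\<^sup>+x. h x \<partial>lborel) = (\<integral>\<^sup>+x. f x \<partial>lebesgue)" by (simp add: nn_integral_completion)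
  qed
qed

lemma nn_integral_lborel_translate:
  fixes h :: "'a::euclidean_space \<Rightarrow> ennreal"
  assumes h: "h \<in> borel_measurable borel"
  shows "(\<integral>\<^sup>+z. h (z + c) \<partial>lborel) = (\<integral>\<^sup>+z. h z \<partial>lborel)"
proof -
  have "(\<integral>\<^sup>+z. h z \<partial>lborel) = (\<integral>\<^sup>+z. h z \<partial>distr lborel borel ((+) c))" by (simp add: lborel_distr_plus)
  also have "\<dots> = (\<integral>\<^sup>+z. h (c + z) \<partial>lborel)" using h by (subst nn_integral_distr) auto
  finally show ?thesis by (simp add: add.commute)
qed

text \<open>
  Tonelli's theorem and translation invariance replace the splitting of the space into a line and a
  complement: averaging the integral over \<open>z + g w\<close> in \<open>z\<close> first gives \<open>\<integral> h\<close> for every \<open>w\<close>.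
\<close>

lemma AE_translates_integrable:
  fixes h :: "'a::euclidean_space \<Rightarrow> ennreal" and g :: "'b::euclidean_space \<Rightarrow> 'a"
  assumes h: "h \<in> borel_measurable borel" and fin: "(\<integral>\<^sup>+x. h x \<partial>lborel) < \<infinity>"
    and g: "continuous_on UNIV g" and S: "S \<in> sets borel" "emeasure lborel S < \<infinity>"
  shows "AE z in lborel. (\<integral>\<^sup>+w. h (z + g w) * indicator S w \<partial>lborel) \<noteq> \<infinity>"
proof (rule nn_integral_PInf_AE)
  have gm: "g \<in> borel_measurable borel" by (rule borel_measurable_continuous_onI[OF g])
  have m: "(\<lambda>p. h (fst p + g (snd p)) * indicator S (snd p)) \<in> borel_measurable (lborel \<Otimes>\<^sub>M lborel)"
    using h gm S(1) by measurable
  show "(\<lambda>z. \<integral>\<^sup>+w. h (z + g w) * indicator S w \<partial>lborel) \<in> borel_measurable lborel"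
    using lborel.borel_measurable_nn_integral_fst[OF m] by simp
  have "(\<integral>\<^sup>+z. (\<integral>\<^sup>+w. h (z + g w) * indicator S w \<partial>lborel) \<partial>lborel)
      = (\<integral>\<^sup>+w. (\<integral>\<^sup>+z. h (z + g w) * indicator S w \<partial>lborel) \<partial>lborel)"
    using lborel_pair.Fubini[OF m] by simp
  also have "\<dots> = (\<integral>\<^sup>+w. (\<integral>\<^sup>+x. h x \<partial>lborel) * indicator S w \<partial>lborel)"
    using h by (subst nn_integral_multc) (auto simp: nn_integral_lborel_translate)
  also have "\<dots> = (\<integral>\<^sup>+x. h x \<partial>lborel) * emeasure lborel S"
    using S by (subst nn_integral_cmult_indicator) auto
  also have "\<dots> < \<infinity>" using fin S by (simp add: ennreal_mult_less_top)
  finally show "(\<integral>\<^sup>+z. (\<integral>\<^sup>+w. h (z + g w) * indicator S w \<partial>lborel) \<partial>lborel) \<noteq> \<infinity>" by simp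
qed

lemma AE_lborel_open_ex:
  fixes W :: "'a::euclidean_space set"
  assumes ae: "AE z in lborel. P z" and W: "open W" "W \<noteq> {}"
  shows "\<exists>z\<in>W. P z"
proof (rule ccontr)
  assume "\<not> (\<exists>z\<in>W. P z)"
  then have "AE z in lborel. z \<notin> W" using ae by (auto elim: eventually_mono)
  then have "AE z in lebesgue. z \<notin> W" by (rule AE_completion)
  then have "W \<in> null_sets lebesgue" using W(1) by (subst AE_iff_null_sets) auto
  then show False using W open_not_negligible by (auto simp: negligible_iff_null_sets)
qed

section \<open>Weights with analytic singularities in one variable\<close>

text \<open>
  Unless all functions vanish near \<open>w0\<close>, factor out of them the smallest order of vanishing \<open>p\<close>
  at \<open>w0\<close>. The quotients have a sum of squares that is continuous and positive at \<open>w0\<close>, hence between positive bounds.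
\<close>

lemma holomorphic_sum_squares_order:
  fixes f :: "nat \<Rightarrow> complex \<Rightarrow> complex"
  assumes V: "open V" "w0 \<in> V" and holo: "\<And>k. k \<in> K \<Longrightarrow> f k holomorphic_on V" and K: "finite K"
  shows "(\<forall>\<^sub>F w in nhds w0. (\<Sum>k\<in>K. (cmod (f k w))\<^sup>2) = 0) \<or>
    (\<exists>p A. 0 < A \<and> (\<forall>\<^sub>F w in nhds w0.
        cmod (w - w0) ^ (2*p) / A \<le> (\<Sum>k\<in>K. (cmod (f k w))\<^sup>2) \<and>
        (\<Sum>k\<in>K. (cmod (f k w))\<^sup>2) \<le> A * cmod (w - w0) ^ (2*p)))"
proof -
  obtain r0 where r0: "0 < r0" "ball w0 r0 \<subseteq> V" using V openE by blast
  define Z where "Z = {k\<in>K. \<exists>w\<in>ball w0 r0. f k w \<noteq> 0}"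
  have ev: "\<forall>\<^sub>F w in nhds w0. w \<in> ball w0 r0" using r0 by (intro eventually_nhds_in_open) auto
  have nZ: "\<forall>\<^sub>F w in nhds w0. f k w = 0" if "k \<in> K" "k \<notin> Z" for k
    using ev by eventually_elim (use that in \<open>auto simp: Z_def\<close>)
  show ?thesis
  proof (cases "Z = {}")
    case True
    have "\<forall>\<^sub>F w in nhds w0. \<forall>k\<in>K. f k w = 0"
      using nZ True K by (intro eventually_ball_finite) auto
    then have "\<forall>\<^sub>F w in nhds w0. (\<Sum>k\<in>K. (cmod (f k w))\<^sup>2) = 0" by eventually_elim simp
    then show ?thesis ..
  next
    case False
    define Q where "Q k n g \<longleftrightarrow> isCont g w0 \<and> g w0 \<noteq> 0 \<and> (\<forall>\<^sub>F w in nhds w0. f k w = g w * (w - w0) ^ n)" for k n g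
    have "\<exists>n g. Q k n g" if "k \<in> Z" for k
    proof -
      have "f k holomorphic_on ball w0 r0" using holo[of k] r0(2) that by (auto simp: Z_def intro: holomorphic_on_subset)
      from zorder_exist_zero[OF this, of w0] r0(1) that
      obtain r where r: "0 < r" "zor_poly (f k) w0 holomorphic_on cball w0 r"
        "\<forall>w\<in>cball w0 r. f k w = zor_poly (f k) w0 w * (w - w0) ^ nat (zorder (f k) w0) \<and> zor_poly (f k) w0 w \<noteq> 0"
        by (auto simp: Z_def)
      have "continuous_on (ball w0 r) (zor_poly (f k) w0)"
        by (rule continuous_on_subset[OF holomorphic_on_imp_continuous_on[OF r(2)]]) auto
      then have "isCont (zor_poly (f k) w0) w0" using r(1) by (auto simp: continuous_on_eq_continuous_at)
      moreover have "\<forall>\<^sub>F w in nhds w0. w \<in> ball w0 r" using r by (intro eventually_nhds_in_open) auto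
      then have "\<forall>\<^sub>F w in nhds w0. f k w = zor_poly (f k) w0 w * (w - w0) ^ nat (zorder (f k) w0)"
        by eventually_elim (use r(3) in auto)
      ultimately have "Q k (nat (zorder (f k) w0)) (zor_poly (f k) w0)" using r unfolding Q_def by auto
      then show ?thesis by blast
    qed
    then obtain n g where "\<And>k. k \<in> Z \<Longrightarrow> Q k (n k) (g k)" by metis
    then have g: "\<And>k. k \<in> Z \<Longrightarrow> isCont (g k) w0" "\<And>k. k \<in> Z \<Longrightarrow> g k w0 \<noteq> 0"
        "\<And>k. k \<in> Z \<Longrightarrow> \<forall>\<^sub>F w in nhds w0. f k w = g k w * (w - w0) ^ n k"
      unfolding Q_def by blast+
    define p where "p = Min (n ` Z)"
    have fZ: "finite Z" using K by (simp add: Z_def)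
    have pn: "p \<le> n k" if "k \<in> Z" for k using that fZ by (simp add: p_def)
    have "p \<in> n ` Z" unfolding p_def using False fZ by (intro Min_in) auto
    then obtain k0 where k0: "k0 \<in> Z" "n k0 = p" by blast
    define G where "G k w = g k w * (w - w0) ^ (n k - p)" for k w
    define H where "H w = (\<Sum>k\<in>Z. (cmod (G k w))\<^sup>2)" for w
    have "isCont H w0" unfolding H_def G_def by (intro continuous_intros g)
    have H0: "0 < H w0"
    proof -
      have "0 < (cmod (G k0 w0))\<^sup>2" using g(2)[OF k0(1)] by (simp add: G_def k0)
      also have "\<dots> \<le> H w0" unfolding H_def using k0 fZ by (intro member_le_sum) auto
      finally show ?thesis .
    qed
    \<comment> \<open>This is at least as large as both 2 H w0 and 2 / H w0, so the interval from 1/A to A contains the values between H w0 / 2 and 2 H w0.\<close>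
    define A where "A = 2 * H w0 + 2 / H w0"
    have A: "0 < A" "2 * H w0 \<le> A" "1 / A \<le> H w0 / 2"
    proof -
      show A0: "0 < A" "2 * H w0 \<le> A" using H0 by (simp_all add: A_def add_pos_pos)
      have "2 / H w0 \<le> A" "0 < 2 / H w0" using H0 by (simp_all add: A_def)
      then have "1 / A \<le> 1 / (2 / H w0)" using A0 by (intro divide_left_mono mult_pos_pos) auto
      then show "1 / A \<le> H w0 / 2" by simp
    qed
    have "(H \<longlongrightarrow> H w0) (nhds w0)" using \<open>isCont H w0\<close> by (simp add: tendsto_nhds_iff isCont_def)
    from order_tendstoD(1)[OF this, of "H w0 / 2"] order_tendstoD(2)[OF this, of "2 * H w0"]
    have evH: "\<forall>\<^sub>F w in nhds w0. H w0 / 2 < H w" "\<forall>\<^sub>F w in nhds w0. H w < 2 * H w0" using H0 by auto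
    have "\<forall>\<^sub>F w in nhds w0. \<forall>k\<in>K. (k \<in> Z \<longrightarrow> f k w = g k w * (w - w0) ^ n k) \<and> (k \<notin> Z \<longrightarrow> f k w = 0)"
      using g(3) nZ K by (intro eventually_ball_finite ballI) (auto simp: eventually_conj_iff)
    then have "\<forall>\<^sub>F w in nhds w0. cmod (w - w0) ^ (2*p) / A \<le> (\<Sum>k\<in>K. (cmod (f k w))\<^sup>2) \<and>
        (\<Sum>k\<in>K. (cmod (f k w))\<^sup>2) \<le> A * cmod (w - w0) ^ (2*p)"
      using evH
    proof eventually_elim
      case (elim w)
      have "(\<Sum>k\<in>K. (cmod (f k w))\<^sup>2) = (\<Sum>k\<in>Z. (cmod (f k w))\<^sup>2)"
        using elim(1) K by (intro sum.mono_neutral_right) (auto simp: Z_def)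
      also have "\<dots> = (\<Sum>k\<in>Z. (cmod (G k w))\<^sup>2 * cmod (w - w0) ^ (2*p))"
      proof (intro sum.cong refl)
        fix k assume k: "k \<in> Z"
        then have "f k w = g k w * (w - w0) ^ n k" using elim(1) by (auto simp: Z_def)
        also have "\<dots> = G k w * (w - w0) ^ p"
          using pn[OF k] by (simp add: G_def mult.assoc flip: power_add)
        finally show "(cmod (f k w))\<^sup>2 = (cmod (G k w))\<^sup>2 * cmod (w - w0) ^ (2*p)"
          by (simp add: norm_mult norm_power power_mult_distrib power_mult[symmetric] mult.commute)
      qed
      also have "\<dots> = H w * cmod (w - w0) ^ (2*p)" by (simp add: H_def sum_distrib_right)
      finally have eq: "(\<Sum>k\<in>K. (cmod (f k w))\<^sup>2) = H w * cmod (w - w0) ^ (2*p)" .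
      have "1 / A * cmod (w - w0) ^ (2*p) \<le> H w * cmod (w - w0) ^ (2*p)"
        using elim A by (intro mult_right_mono) auto
      moreover have "H w * cmod (w - w0) ^ (2*p) \<le> A * cmod (w - w0) ^ (2*p)"
        using elim A by (intro mult_right_mono) auto
      ultimately show ?case unfolding eq by simp
    qed
    then show ?thesis using A(1) by blast
  qed
qed

text \<open>
  The exponent is \<open>q = c p\<close>, where \<open>p\<close> is the common vanishing order of the \<open>f\<^sub>k\<close>; the bounded error terms
  turn into the factor \<open>A\<close>. The first alternative is the case in which all \<open>f\<^sub>k\<close> vanish near \<open>w0\<close>.
\<close>

lemma analytic_singularities_exp:
  assumes an: "analytic_singularities_on S u" and w0: "w0 \<in> S"
  obtains "\<forall>\<^sub>F w in at w0. u w = -\<infinity>"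
  | q A where "0 < A" "\<forall>\<^sub>F w in at w0. \<exists>v. eexp (- 2 * u w) = ereal v \<and>
       exp (- 2 * q * ln (cmod (w - w0))) / A \<le> v \<and> v \<le> A * exp (- 2 * q * ln (cmod (w - w0)))"
proof -
  from bspec[OF an[unfolded analytic_singularities_on_def] w0]
  obtain V and c :: real and m :: nat and f :: "nat \<Rightarrow> complex \<Rightarrow> complex" and C :: real
    where *: "open V \<and> w0 \<in> V \<and> V \<subseteq> S \<and> 0 < c \<and> 1 \<le> m \<and> (\<forall>k\<in>{1..m}. f k holomorphic_on V) \<and>
        (\<forall>w\<in>V. ereal (c / 2) * elog (\<Sum>k=1..m. (cmod (f k w))\<^sup>2) - ereal C \<le> u w \<and>
                u w \<le> ereal (c / 2) * elog (\<Sum>k=1..m. (cmod (f k w))\<^sup>2) + ereal C)"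
    by (elim exE) (rule that)
  then have V: "open V" "w0 \<in> V" and c: "0 < c" and f: "\<And>k. k \<in> {1..m} \<Longrightarrow> f k holomorphic_on V"
      and b: "\<And>w. w \<in> V \<Longrightarrow> ereal (c / 2) * elog (\<Sum>k=1..m. (cmod (f k w))\<^sup>2) - ereal C \<le> u w"
        "\<And>w. w \<in> V \<Longrightarrow> u w \<le> ereal (c / 2) * elog (\<Sum>k=1..m. (cmod (f k w))\<^sup>2) + ereal C"
    by blast+
  define F where "F w = (\<Sum>k=1..m. (cmod (f k w))\<^sup>2)" for w
  have evV: "\<forall>\<^sub>F w in nhds w0. w \<in> V" using V by (rule eventually_nhds_in_open)
  consider "\<forall>\<^sub>F w in nhds w0. F w = 0" | p A where "0 < A"
      "\<forall>\<^sub>F w in nhds w0. cmod (w - w0) ^ (2*p) / A \<le> F w \<and> F w \<le> A * cmod (w - w0) ^ (2*p)"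
    using holomorphic_sum_squares_order[OF V, of "{1..m}" f] f unfolding F_def by auto
  then show thesis
  proof cases
    case 1
    have "\<forall>\<^sub>F w in nhds w0. u w = -\<infinity>"
      using 1 evV
    proof eventually_elim
      case (elim w)
      have "u w \<le> ereal (c / 2) * elog (F w) + ereal C" using b(2)[OF elim(2)] unfolding F_def .
      also have "\<dots> = -\<infinity>" using elim c by (simp add: elog_zero)
      finally show ?case by simp
    qed
    then show thesis by (intro that(1)) (auto simp: eventually_at_filter elim: eventually_mono)
  next
    case 2
    define q where "q = c * real p"
    define D where "D = c / 2 * ln A + C"
    show thesis
    proof (rule that(2))
      show "0 < exp (2 * D)" by simp
      have "\<forall>\<^sub>F w in at w0. w \<in> V" "\<forall>\<^sub>F w in at w0. w \<noteq> w0"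
        "\<forall>\<^sub>F w in at w0. cmod (w - w0) ^ (2*p) / A \<le> F w \<and> F w \<le> A * cmod (w - w0) ^ (2*p)"
        using evV 2(2) by (auto simp: eventually_at_filter elim: eventually_mono)
      then show "\<forall>\<^sub>F w in at w0. \<exists>v. eexp (- 2 * u w) = ereal v \<and>
       exp (- 2 * q * ln (cmod (w - w0))) / exp (2 * D) \<le> v \<and> v \<le> exp (2 * D) * exp (- 2 * q * ln (cmod (w - w0)))"
      proof eventually_elim
        case (elim w)
        define s where "s = cmod (w - w0)"
        have s: "0 < s" using elim by (simp add: s_def)
        have lo: "s ^ (2*p) / A \<le> F w" and hi: "F w \<le> A * s ^ (2*p)" using elim by (auto simp: s_def)
        have "0 < s ^ (2*p) / A" using s 2(1) by simp
        then have F: "0 < F w" using lo by linarith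
        have "ln (s ^ (2*p) / A) \<le> ln (F w)" using lo s 2(1) by (intro ln_mono) auto
        then have lnlo: "2 * real p * ln s - ln A \<le> ln (F w)" using s 2(1) by (simp add: ln_div ln_realpow)
        have "ln (F w) \<le> ln (A * s ^ (2*p))" using hi F by (intro ln_mono) auto
        then have lnhi: "ln (F w) \<le> 2 * real p * ln s + ln A" using s 2(1) by (simp add: ln_mult ln_realpow)
        have "ereal (c / 2 * ln (F w) - C) \<le> u w" "u w \<le> ereal (c / 2 * ln (F w) + C)"
          using b[OF elim(1), folded F_def] F by (simp_all add: elog_pos)
        then obtain t where t: "u w = ereal t" "c / 2 * ln (F w) - C \<le> t" "t \<le> c / 2 * ln (F w) + C"
          by (cases "u w") auto
        have "c / 2 * (2 * real p * ln s - ln A) \<le> c / 2 * ln (F w)"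
             "c / 2 * ln (F w) \<le> c / 2 * (2 * real p * ln s + ln A)"
          using lnlo lnhi c by (auto intro!: mult_left_mono)
        then have "q * ln s - D \<le> t" "t \<le> q * ln s + D"
          using t(2,3) by (auto simp: q_def D_def algebra_simps)
        then have "exp (- 2 * q * ln s) / exp (2 * D) \<le> exp (- 2 * t)" "exp (- 2 * t) \<le> exp (2 * D) * exp (- 2 * q * ln s)"
          by (simp_all flip: exp_diff exp_add)
        moreover have "eexp (- 2 * u w) = ereal (exp (- 2 * t))" by (simp add: t(1))
        ultimately show ?case unfolding s_def by blast
      qed
    qed
  qed
qed

section \<open>Failure of integrability\<close>

text \<open>
  The dichotomy at the heart of the argument. For \<open>q \<le> 1\<close> the first weight exceeds
  \<open>(A + 1) exp (-2 ln x)\<close> because the series tends to \<open>-\<infinity>\<close>. For \<open>q > 1\<close> write \<open>q = 1 + 2d\<close> and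
  \<open>X = exp (-2d ln x)\<close>: after division by \<open>exp (-2 ln x)\<close> the second weight is at least \<open>X\<^sup>2/A\<close>, while the
  first is at most a constant times \<open>X\<close>.
\<close>

lemma slice_weight_gap:
  assumes M: "M \<ge> 2" and y: "0 < y" "y \<le> 1/2" and A: "0 < A"
  obtains r where "0 < r" "\<And>x v. 0 < x \<Longrightarrow> x < r \<Longrightarrow>
     exp (- 2 * q * ln x) / A \<le> v \<Longrightarrow> v \<le> A * exp (- 2 * q * ln x) \<Longrightarrow>
     1 / x\<^sup>2 \<le> \<bar>exp (- 2 * (ln x + log_series M x y)) - v\<bar>"
proof -
  have sq: "1 / x\<^sup>2 = exp (- 2 * ln x)" if "0 < x" for x :: real
  proof -
    have "exp (- 2 * ln x) = inverse (exp (ln x) ^ 2)" by (simp add: exp_minus exp_double)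
    then show ?thesis using that by (simp add: inverse_eq_divide)
  qed
  show thesis
  proof (cases "q \<le> 1")
    case True
    obtain r where r: "0 < r" "\<And>x. 0 < x \<Longrightarrow> x < r \<Longrightarrow> log_series M x y \<le> - (ln (A + 1) / 2)"
      using log_series_at_bot[OF M y] by metis
    show thesis
    proof (rule that)
      show "0 < min r 1" using r by simp
      fix x v assume x: "0 < x" "x < min r 1" and v: "v \<le> A * exp (- 2 * q * ln x)"
      have l: "ln x \<le> 0" using x by simp
      have "- 2 * q * ln x \<le> - 2 * ln x" using mult_right_mono_neg[OF True l] by simp
      then have "A * exp (- 2 * q * ln x) \<le> A * exp (- 2 * ln x)" using A by simp
      moreover have "(A + 1) * exp (- 2 * ln x) \<le> exp (- 2 * (ln x + log_series M x y))"
      proof -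
        have "(A + 1) * exp (- 2 * ln x) = exp (ln (A + 1) - 2 * ln x)" using A by (simp add: exp_diff exp_minus field_simps)
        also have "\<dots> \<le> exp (- 2 * (ln x + log_series M x y))" using r(2)[of x] x by simp
        finally show ?thesis .
      qed
      ultimately have "exp (- 2 * ln x) \<le> exp (- 2 * (ln x + log_series M x y)) - v" using v by (simp add: distrib_right)
      then show "1 / x\<^sup>2 \<le> \<bar>exp (- 2 * (ln x + log_series M x y)) - v\<bar>" using sq x by simp
    qed
  next
    case False
    define d where "d = (q - 1) / 2"
    have d: "0 < d" "q = 1 + 2 * d" using False by (auto simp: d_def field_simps)
    obtain C where C: "\<And>x. 0 < x \<Longrightarrow> x \<le> 1 \<Longrightarrow> d * ln x - C \<le> log_series M x y"
      using log_series_sublogarithmic[OF M y(1) d(1)] by metis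
    \<comment> \<open>For x small enough that X > T, the factor X / A beats the constant exp (2C) with 1 to spare.\<close>
    define T where "T = A * (exp (2 * C) + 1)"
    have T: "0 < T" using A by (simp add: T_def add_pos_pos)
    show thesis
    proof (rule that)
      show "0 < min 1 (exp (- ln T / (2 * d)))" by simp
      fix x v assume x: "0 < x" "x < min 1 (exp (- ln T / (2 * d)))" and v: "exp (- 2 * q * ln x) / A \<le> v"
      define X where "X = exp (- 2 * d * ln x)"
      have "ln x < - ln T / (2 * d)" using x by (metis exp_less_cancel_iff exp_ln min_less_iff_conj)
      then have "ln T < - 2 * d * ln x" using d by (simp add: field_simps)
      then have "T < X" unfolding X_def using T by (metis exp_less_mono exp_ln)
      then have XA: "exp (2 * C) + 1 < X / A" using A by (simp add: T_def field_simps)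
      have "0 < - ln x" using x by simp
      then have X1: "1 \<le> X" unfolding X_def using d by (simp add: mult_le_0_iff)
      have e1: "exp (- 2 * q * ln x) / A = exp (- 2 * ln x) * (X * (X / A))"
        by (simp add: X_def d(2) algebra_simps flip: exp_add)
      have "exp (- 2 * (ln x + log_series M x y)) \<le> exp (- 2 * ln x + - 2 * d * ln x + 2 * C)"
        using C[of x] x by simp
      also have "\<dots> = exp (- 2 * ln x) * (X * exp (2 * C))" by (simp only: exp_add X_def mult.assoc)
      finally have e2: "exp (- 2 * (ln x + log_series M x y)) \<le> exp (- 2 * ln x) * (X * exp (2 * C))" .
      have "1 \<le> X * (X / A) - X * exp (2 * C)"
      proof -
        have "X * 1 \<le> X * (X / A - exp (2 * C))" using XA X1 by (intro mult_left_mono) auto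
        then show ?thesis using X1 by (simp add: right_diff_distrib)
      qed
      then have "exp (- 2 * ln x) * 1 \<le> exp (- 2 * ln x) * (X * (X / A) - X * exp (2 * C))"
        by (intro mult_left_mono) auto
      then have "exp (- 2 * ln x) \<le> v - exp (- 2 * (ln x + log_series M x y))"
        using e1 e2 v unfolding mult_1_right right_diff_distrib by linarith
      then show "1 / x\<^sup>2 \<le> \<bar>exp (- 2 * (ln x + log_series M x y)) - v\<bar>" using sq x by simp
    qed
  qed
qed

lemma eexp_infinity [simp]: "eexp \<infinity> = \<infinity>"
  using eexp.simps(2) unfolding infinity_ereal_def .

lemma norm_axis: "norm (axis i x :: 'a::real_normed_vector ^ 'n) = norm x"
proof -
  have eq: "(norm (if j = i then x else 0))\<^sup>2 = (if j = i then (norm x)\<^sup>2 else 0)" for j by simp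
  show ?thesis by (simp add: norm_vec_def L2_set_def axis_def eq)
qed

text \<open>
  If \<open>u\<close> is \<open>-\<infinity>\<close> near the point where the line meets the hyperplane, then the difference is \<open>-\<infinity>\<close> there
  except at that point, and its absolute value \<open>\<infinity>\<close>.
\<close>

lemma exp_diff_lower_bound_on_line:
  fixes z :: "complex ^ 'n"
  assumes M: "M \<ge> 2" and ne: "i1 \<noteq> i2" and y: "0 < cmod (z $ i2)" "cmod (z $ i2) \<le> 1/2"
    and an: "analytic_singularities_on S (\<lambda>w. u (z + w *s axis i1 1))" and S: "- (z $ i1) \<in> S"
  shows "\<forall>\<^sub>F w in at (- (z $ i1)). ennreal (1 / (cmod (w + z $ i1))\<^sup>2)
           \<le> e2ennreal \<bar>exp_diff (phi i1 i2 M) u (z + w *s axis i1 1)\<bar>"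
proof -
  define w0 where "w0 = - (z $ i1)"
  define E where "E w = exp (- 2 * (ln (cmod (w - w0)) + log_series M (cmod (w - w0)) (cmod (z $ i2))))" for w
  have e1: "exp_diff (phi i1 i2 M) u (z + w *s axis i1 1) = ereal (E w) - eexp (- 2 * u (z + w *s axis i1 1))"
    if "w \<noteq> w0" for w
  proof -
    have c: "(z + w *s axis i1 1) $ i1 = w - w0" "(z + w *s axis i1 1) $ i2 = z $ i2"
      using ne by (simp_all add: axis_def w0_def)
    then have nz: "(z + w *s axis i1 1) $ i1 \<noteq> 0" using that by simp
    show ?thesis unfolding exp_diff_def phi_off_hyperplane[OF M nz] c by (simp add: E_def)
  qed
  have ev: "\<forall>\<^sub>F w in at w0. w \<noteq> w0" by (simp add: eventually_at_filter)
  have "\<forall>\<^sub>F w in at w0. ennreal (1 / (cmod (w - w0))\<^sup>2)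
           \<le> e2ennreal \<bar>exp_diff (phi i1 i2 M) u (z + w *s axis i1 1)\<bar>"
    using an S[folded w0_def]
  proof (cases rule: analytic_singularities_exp)
    case 1
    with ev show ?thesis by eventually_elim (simp add: e1)
  next
    case (2 q A)
    obtain r where r: "0 < r" "\<And>x v. 0 < x \<Longrightarrow> x < r \<Longrightarrow>
       exp (- 2 * q * ln x) / A \<le> v \<Longrightarrow> v \<le> A * exp (- 2 * q * ln x) \<Longrightarrow>
       1 / x\<^sup>2 \<le> \<bar>exp (- 2 * (ln x + log_series M x (cmod (z $ i2)))) - v\<bar>"
      using slice_weight_gap[OF M y 2(1)] by metis
    have "\<forall>\<^sub>F w in at w0. dist w w0 < r" using r(1) by (auto simp: eventually_at)
    with 2(2) ev show ?thesis
    proof eventually_elim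
      case (elim w)
      then obtain v where v: "eexp (- 2 * u (z + w *s axis i1 1)) = ereal v"
        "exp (- 2 * q * ln (cmod (w - w0))) / A \<le> v" "v \<le> A * exp (- 2 * q * ln (cmod (w - w0)))" by blast
      have "1 / (cmod (w - w0))\<^sup>2 \<le> \<bar>E w - v\<bar>"
        unfolding E_def using elim by (intro r(2) v) (auto simp: dist_norm)
      then show ?case unfolding e1[OF elim(2)] v(1) by (simp add: e2ennreal_ereal ennreal_leI)
    qed
  qed
  then show ?thesis by (simp add: w0_def)
qed

text \<open>
  The estimate on lines is applied to one \<open>z\<close> which is small, has \<open>z\<^sub>2 \<noteq> 0\<close>, and whose line is among the
  almost all lines on which the majorant \<open>h\<close> of the difference is integrable. The point where this line meets the
  hyperplane has the parameter \<open>w0 = - z\<^sub>1\<close>.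
\<close>

lemma exp_diff_not_locally_integrable:
  fixes u :: "complex ^ 'n \<Rightarrow> ereal"
  assumes M: "M \<ge> 2" and ne: "i1 \<noteq> i2"
    and X: "0 \<in> X" "generalized_analytic_singularities_on X u" and U: "0 \<in> U"
  shows "\<not> locally_integrable_on U (exp_diff (phi i1 i2 M) u)"
proof
  define f where "f = exp_diff (phi i1 i2 M) u"
  define g :: "complex \<Rightarrow> complex ^ 'n" where "g w = w *s axis i1 1" for w
  have gn: "norm (g w) = cmod w" for w
  proof -
    have "g w = axis i1 w" by (simp add: g_def axis_def vec_eq_iff)
    then show ?thesis by (simp add: norm_axis)
  qed
  have g_add: "g (a + b) = g a + g b" for a b by (simp add: g_def vec_eq_iff algebra_simps)
  assume "locally_integrable_on U (exp_diff (phi i1 i2 M) u)"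
  then obtain V where V: "open V" "0 \<in> V" "f \<in> borel_measurable (lebesgue_on V)"
      "(\<integral>\<^sup>+ x. e2ennreal \<bar>f x\<bar> \<partial>lebesgue_on V) < \<infinity>"
    using U unfolding locally_integrable_on_def ext_integrable_on_def f_def by blast
  obtain r1 where r1: "0 < r1" "\<And>a b. b \<noteq> 0 \<Longrightarrow>
      analytic_singularities_on {w. a + w *s b \<in> ball 0 r1} (\<lambda>w. u (a + w *s b))"
    using X unfolding generalized_analytic_singularities_on_def by metis
  obtain r2 where r2: "0 < r2" "ball 0 r2 \<subseteq> V" using V openE by blast
  define r where "r = min r1 r2"
  have r: "0 < r" "r \<le> r1" "ball 0 r \<subseteq> V" using r1(1) r2 by (auto simp: r_def)
  define F where "F x = e2ennreal \<bar>f x\<bar> * indicator V x" for x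
  have Vs: "V \<in> sets lebesgue" using V(1) by (simp add: borel_open)
  have "(\<lambda>x. e2ennreal \<bar>f x\<bar>) \<in> borel_measurable (lebesgue_on V)" using V(3) by measurable
  then have "F \<in> borel_measurable lebesgue"
    using Vs by (simp add: F_def[abs_def] borel_measurable_restrict_space_iff_ennreal)
  from lebesgue_measurable_borel_majorant[OF this]
  obtain h where h: "h \<in> borel_measurable borel" "\<And>x. F x \<le> h x"
      "(\<integral>\<^sup>+x. h x \<partial>lborel) = (\<integral>\<^sup>+x. F x \<partial>lebesgue)" by metis
  have "(\<integral>\<^sup>+x. h x \<partial>lborel) = (\<integral>\<^sup>+ x. e2ennreal \<bar>f x\<bar> \<partial>lebesgue_on V)"
    unfolding h(3) F_def using Vs by (subst nn_integral_restrict_space) auto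
  then have hfin: "(\<integral>\<^sup>+x. h x \<partial>lborel) < \<infinity>" using V(4) by simp
  have "continuous_on UNIV g" unfolding g_def vector_scalar_mult_def by (intro continuous_intros)
  from AE_translates_integrable[OF h(1) hfin this, of "ball 0 r"]
  have ae: "AE z in lborel. (\<integral>\<^sup>+w. h (z + g w) * indicator (ball 0 r) w \<partial>lborel) \<noteq> \<infinity>"
    using emeasure_lborel_ball_finite[of "0::complex" r] by simp
  \<comment> \<open>With r/4 the point where the line meets the hyperplane has norm below r/2, which leaves room for a disc of radius r/2 in the line; 1/2 is the bound on the second coordinate required on slices.\<close>
  define e where "e = min (r/4) (1/2)"
  have e: "0 < e" using r by (simp add: e_def)
  define D where "D = ball 0 e \<inter> {z :: complex ^ 'n. z $ i2 \<noteq> 0}"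
  have "open D"
    unfolding D_def by (intro open_Int open_ball open_Collect_neq continuous_intros)
  moreover have "axis i2 (of_real (e/2)) \<in> D"
    using e by (simp add: D_def norm_axis)
  then have "D \<noteq> {}" by blast
  ultimately obtain z where "z \<in> D"
     and zfin: "(\<integral>\<^sup>+w. h (z + g w) * indicator (ball 0 r) w \<partial>lborel) \<noteq> \<infinity>"
    using AE_lborel_open_ex[OF ae] by blast
  then have z: "norm z < e" "z $ i2 \<noteq> 0" by (simp_all add: D_def)
  define w0 where "w0 = - (z $ i1)"
  have w0: "cmod w0 < e" using z Finite_Cartesian_Product.norm_nth_le[of z i1] by (simp add: w0_def)
  have zw: "norm (z + g w) < r / 2 + cmod (w - w0)" for w
  proof -
    have "z + g w = z + g w0 + g (w - w0)" by (simp flip: g_add add: add.assoc)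
    then have "norm (z + g w) \<le> norm z + norm (g w0) + norm (g (w - w0))"
      by (metis norm_triangle_ineq add_right_mono order_trans)
    then show ?thesis using z(1) w0 by (simp add: gn e_def)
  qed
  have z2: "0 < cmod (z $ i2)" "cmod (z $ i2) \<le> 1/2"
    using z Finite_Cartesian_Product.norm_nth_le[of z i2] by (auto simp: e_def)
  have "axis i1 (1::complex) \<noteq> 0" by (simp add: axis_eq_0_iff)
  note an = r1(2)[OF this, of z]
  have "- (z $ i1) \<in> {w. z + w *s axis i1 1 \<in> ball 0 r1}"
    using zw[of w0] r by (simp flip: g_def w0_def)
  from exp_diff_lower_bound_on_line[OF M ne z2 an this]
  obtain d where d: "0 < d" "\<And>w. w \<noteq> w0 \<Longrightarrow> dist w w0 < d \<Longrightarrow>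
      ennreal (1 / (cmod (w - w0))\<^sup>2) \<le> e2ennreal \<bar>f (z + g w)\<bar>"
    unfolding eventually_at by (auto simp: w0_def f_def g_def)
  define d' where "d' = min d (r/2)"
  have [measurable]: "ball (0::complex) d' \<in> sets borel" by simp
  have "\<infinity> = (\<integral>\<^sup>+w. ennreal (1 / (cmod w)\<^sup>2) * indicator (ball 0 d') w \<partial>lborel)"
    using d r by (subst nn_integral_inverse_square_ball) (auto simp: d'_def)
  also have "\<dots> = (\<integral>\<^sup>+w. ennreal (1 / (cmod (w + - w0))\<^sup>2) * indicator (ball 0 d') (w + - w0) \<partial>lborel)"
    by (rule nn_integral_lborel_translate[symmetric]) measurable
  also have "\<dots> \<le> (\<integral>\<^sup>+w. h (z + g w) * indicator (ball 0 r) w \<partial>lborel)"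
  proof (rule nn_integral_mono)
    fix w
    show "ennreal (1 / (cmod (w + - w0))\<^sup>2) * indicator (ball 0 d') (w + - w0)
        \<le> h (z + g w) * indicator (ball 0 r) w"
    proof (cases "w \<noteq> w0 \<and> cmod (w - w0) < d'")
      case True
      have "cmod w \<le> cmod w0 + cmod (w - w0)" using norm_triangle_ineq[of w0 "w - w0"] by simp
      then have "w \<in> ball 0 r" using True w0 r(1) by (auto simp: d'_def e_def)
      have "z + g w \<in> V" using zw[of w] True r by (intro subsetD[OF r(3)]) (auto simp: d'_def)
      then have "e2ennreal \<bar>f (z + g w)\<bar> \<le> h (z + g w)" using h(2)[of "z + g w"] by (simp add: F_def)
      moreover have "ennreal (1 / (cmod (w - w0))\<^sup>2) \<le> e2ennreal \<bar>f (z + g w)\<bar>"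
        using True by (intro d(2)) (auto simp: d'_def dist_norm)
      ultimately show ?thesis using True \<open>w \<in> ball 0 r\<close> by (simp add: order_trans)
    next
      case False
      then show ?thesis by (auto simp: indicator_def)
    qed
  qed
  finally show False using zfin by (simp add: top_unique)
qed

theorem theorem1p3:
  fixes i1 i2 :: "'n::finite"
  assumes n: "CARD('n) \<ge> 2" and coords: "i1 \<noteq> i2"
  shows "\<exists>M0::real. M0 \<ge> 2 \<and> (\<forall>M::real. M \<ge> M0 \<longrightarrow>
           plurisubharmonic_on UNIV (phi i1 i2 M) \<and>
           (\<forall>X (\<phi>A :: complex ^ 'n \<Rightarrow> ereal).
              open X \<and> 0 \<in> X \<and> plurisubharmonic_on X \<phi>A \<and>
              generalized_analytic_singularities_on X \<phi>A \<longrightarrow>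
              \<not> (\<exists>U. open U \<and> 0 \<in> U \<and> U \<subseteq> X \<and>
                     locally_integrable_on U (exp_diff (phi i1 i2 M) \<phi>A))))"
proof (intro exI[of _ "2::real"] conjI allI impI notI)
  fix M :: real assume M: "2 \<le> M"
  show "plurisubharmonic_on UNIV (phi i1 i2 M)" by (rule plurisubharmonic_phi[OF M])
  fix X and \<phi>A :: "complex ^ 'n \<Rightarrow> ereal"
  assume "open X \<and> 0 \<in> X \<and> plurisubharmonic_on X \<phi>A \<and> generalized_analytic_singularities_on X \<phi>A"
    and "\<exists>U. open U \<and> 0 \<in> U \<and> U \<subseteq> X \<and> locally_integrable_on U (exp_diff (phi i1 i2 M) \<phi>A)"
  then show False using exp_diff_not_locally_integrable[OF M coords] by blast
qed simp

end
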